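(* Let $\Gamma$ be a finite unpinched graph. If $A(\Gamma)$ admits a coarsely separating family of subexponential growth, then so does $A(\Gamma')$ for some finite triangle-free unpinched graph $\Gamma'$.
   Context: Graphs are simple. A graph is unpinched if it is neither complete nor separated by a clique (i.e. there is no complete subgraph $C$, possibly empty, such that removing $C$ leaves a disconnected graph). $A(\Gamma)$ is the right-angled Artin group generated by $V(\Gamma)$, two generators commuting whenever the vertices are adjacent, with the word metric of a finite generating set. Coarse separation. For a metric space $X$, $Z \subseteq X$ and $L \geq 0$, set $Z^{+L} = \{x \in X \mid d(x,Z) \leq L\}$. A subset is $k$-connected if any two of its points are joined by a finite chain of points of the subset with consecutive points at distance $\leq k$; $k$-connected components are maximal $k$-connected subsets. A space $X$ is coarsely separated by a collection $\mathcal{Z}$ of subspaces if there exist $k, L \geq 0$ such that $X$ is $k$-connected and, for every $D \geq 0$, there is $Z \in \mathcal{Z}$ such that $X \setminus Z^{+L}$ has at least two $k$-connected components containing points at distance $\geq D$ from $Z$. Growth. For a family $\mathcal{S}$ of subsets of a bounded degree graph $X$ (here a Cayley graph, identified with its vertex-set with the graph metric), set $V_{\mathcal{S}}(R) = \sup_{s \in S,\, S \in \mathcal{S}} |B_X(s,R) \cap S|$. The family has exponential growth if $\limsup_{r \to \infty} \frac{1}{r} \log V_{\mathcal{S}}(r) > 0$, and subexponential growth otherwise. *)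

theory Defs
  imports
    "HOL-Algebra.Generated_Groups"
    "HOL-Analysis.Analysis"
    "Graph_Theory.Graph_Theory"
begin

section \<open>Graphs\<close>

text \<open>
  Finite simple graphs are the graphs satisfying \<^locale>\<open>pair_graph\<close>: finite, loop-free, with a
  symmetric set of arcs and no parallel arcs.
\<close>

definition is_clique :: "'a pair_pre_digraph \<Rightarrow> 'a set \<Rightarrow> bool" where
  "is_clique \<Gamma> C \<longleftrightarrow>
     C \<subseteq> pverts \<Gamma> \<and> (\<forall>u\<in>C. \<forall>v\<in>C. u \<noteq> v \<longrightarrow> (u, v) \<in> parcs \<Gamma>)"

definition complete_graph :: "'a pair_pre_digraph \<Rightarrow> bool" where
  "complete_graph \<Gamma> \<longleftrightarrow> is_clique \<Gamma> (pverts \<Gamma>)"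

text \<open>
  The Graph\_Theory predicate \<^const>\<open>Digraph_Component.connected\<close> is false for the graph without
  vertices. This is harmless in \<open>unpinched\<close>: removing \<open>C\<close> leaves no vertex only if \<open>C\<close> is the whole
  vertex set, and then the graph is complete.
\<close>

definition separated_by_clique :: "'a pair_pre_digraph \<Rightarrow> bool" where
  "separated_by_clique \<Gamma> \<longleftrightarrow>
     (\<exists>C. is_clique \<Gamma> C \<and>
          \<not> Digraph_Component.connected (induce_subgraph (with_proj \<Gamma>) (pverts \<Gamma> - C)))"

definition unpinched :: "'a pair_pre_digraph \<Rightarrow> bool" where
  "unpinched \<Gamma> \<longleftrightarrow> \<not> complete_graph \<Gamma> \<and> \<not> separated_by_clique \<Gamma>"

definition triangle_free :: "'a pair_pre_digraph \<Rightarrow> bool" where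
  "triangle_free \<Gamma> \<longleftrightarrow>
     \<not> (\<exists>u v w. (u, v) \<in> parcs \<Gamma> \<and> (v, w) \<in> parcs \<Gamma> \<and> (w, u) \<in> parcs \<Gamma>)"


section \<open>Right-angled Artin groups\<close>

text \<open>
  The group given by the presentation with generators \<open>V(\<Gamma>)\<close> and relations \<open>uv = vu\<close> for adjacent
  \<open>u, v\<close>. The letter \<open>(v, True)\<close> stands for \<open>v\<close> and \<open>(v, False)\<close> for its inverse.
\<close>

type_synonym 'a word = "('a \<times> bool) list"

definition raag_words :: "'a pair_pre_digraph \<Rightarrow> 'a word set" where
  "raag_words \<Gamma> = lists (pverts \<Gamma> \<times> UNIV)"

inductive raag_eq :: "'a pair_pre_digraph \<Rightarrow> 'a word \<Rightarrow> 'a word \<Rightarrow> bool" for \<Gamma> where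
  refl: "w \<in> raag_words \<Gamma> \<Longrightarrow> raag_eq \<Gamma> w w"
| sym: "raag_eq \<Gamma> w w' \<Longrightarrow> raag_eq \<Gamma> w' w"
| trans: "raag_eq \<Gamma> w w' \<Longrightarrow> raag_eq \<Gamma> w' w'' \<Longrightarrow> raag_eq \<Gamma> w w''"
| cancel: "xs @ [(v, b), (v, \<not> b)] @ ys \<in> raag_words \<Gamma> \<Longrightarrow>
    raag_eq \<Gamma> (xs @ [(v, b), (v, \<not> b)] @ ys) (xs @ ys)"
| commute: "xs @ [(u, True), (v, True)] @ ys \<in> raag_words \<Gamma> \<Longrightarrow> (u, v) \<in> parcs \<Gamma> \<Longrightarrow>
    raag_eq \<Gamma> (xs @ [(u, True), (v, True)] @ ys) (xs @ [(v, True), (u, True)] @ ys)"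

definition raag_rel :: "'a pair_pre_digraph \<Rightarrow> 'a word rel" where
  "raag_rel \<Gamma> = {(w, w'). raag_eq \<Gamma> w w'}"

definition raag :: "'a pair_pre_digraph \<Rightarrow> 'a word set monoid" where
  "raag \<Gamma> =
     \<lparr> carrier = raag_words \<Gamma> // raag_rel \<Gamma>,
       monoid.mult = (\<lambda>A B. \<Union>a\<in>A. \<Union>b\<in>B. raag_rel \<Gamma> `` {a @ b}),
       monoid.one = raag_rel \<Gamma> `` {[]} \<rparr>"

definition raag_gen :: "'a pair_pre_digraph \<Rightarrow> 'a \<Rightarrow> 'a word set" where
  "raag_gen \<Gamma> v = raag_rel \<Gamma> `` {[(v, True)]}"

lemma raag_words_simps [simp]:
  "[] \<in> raag_words \<Gamma>"
  "x # xs \<in> raag_words \<Gamma> \<longleftrightarrow> fst x \<in> pverts \<Gamma> \<and> xs \<in> raag_words \<Gamma>"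
  "xs @ ys \<in> raag_words \<Gamma> \<longleftrightarrow> xs \<in> raag_words \<Gamma> \<and> ys \<in> raag_words \<Gamma>"
  by (cases x; auto simp: raag_words_def)+

lemma raag_eq_words: "raag_eq \<Gamma> w w' \<Longrightarrow> w \<in> raag_words \<Gamma> \<and> w' \<in> raag_words \<Gamma>"
  by (induction rule: raag_eq.induct) auto

lemma equiv_raag_rel: "equiv (raag_words \<Gamma>) (raag_rel \<Gamma>)"
proof (rule equivI)
  show "raag_rel \<Gamma> \<subseteq> raag_words \<Gamma> \<times> raag_words \<Gamma>"
    by (auto simp: raag_rel_def dest: raag_eq_words)
  show "refl_on (raag_words \<Gamma>) (raag_rel \<Gamma>)"
    by (auto simp: refl_on_def raag_rel_def intro: raag_eq.refl)
  show "sym (raag_rel \<Gamma>)"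
    by (auto simp: sym_def raag_rel_def intro: raag_eq.sym)
  show "trans (raag_rel \<Gamma>)"
    by (auto simp: trans_def raag_rel_def intro: raag_eq.trans)
qed

lemma raag_eq_append_left:
  "raag_eq \<Gamma> w w' \<Longrightarrow> zs \<in> raag_words \<Gamma> \<Longrightarrow> raag_eq \<Gamma> (zs @ w) (zs @ w')"
proof (induction rule: raag_eq.induct)
  case (cancel xs v b ys)
  then show ?case using raag_eq.cancel[of "zs @ xs" v b ys \<Gamma>] by simp
next
  case (commute xs u v ys)
  then show ?case using raag_eq.commute[of "zs @ xs" u v ys \<Gamma>] by simp
qed (auto intro: raag_eq.intros)

lemma raag_eq_append_right:
  "raag_eq \<Gamma> w w' \<Longrightarrow> zs \<in> raag_words \<Gamma> \<Longrightarrow> raag_eq \<Gamma> (w @ zs) (w' @ zs)"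
proof (induction rule: raag_eq.induct)
  case (cancel xs v b ys)
  then show ?case using raag_eq.cancel[of xs v b "ys @ zs" \<Gamma>] by simp
next
  case (commute xs u v ys)
  then show ?case using raag_eq.commute[of xs u v "ys @ zs" \<Gamma>] by simp
qed (auto intro: raag_eq.intros)

lemma raag_class_eq_iff:
  "w \<in> raag_words \<Gamma> \<Longrightarrow> w' \<in> raag_words \<Gamma> \<Longrightarrow>
     raag_rel \<Gamma> `` {w} = raag_rel \<Gamma> `` {w'} \<longleftrightarrow> raag_eq \<Gamma> w w'"
  using eq_equiv_class_iff[OF equiv_raag_rel, of w \<Gamma> w'] by (simp add: raag_rel_def)

lemma raag_mult:
  assumes "v \<in> raag_words \<Gamma>" "w \<in> raag_words \<Gamma>"
  shows "raag_rel \<Gamma> `` {v} \<otimes>\<^bsub>raag \<Gamma>\<^esub> raag_rel \<Gamma> `` {w} = raag_rel \<Gamma> `` {v @ w}"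
proof -
  have "congruent2 (raag_rel \<Gamma>) (raag_rel \<Gamma>) (\<lambda>a b. raag_rel \<Gamma> `` {a @ b})"
  proof (rule congruent2I'[of "raag_rel \<Gamma>" "raag_rel \<Gamma>"])
    fix a a' b b' assume *: "(a, a') \<in> raag_rel \<Gamma>" "(b, b') \<in> raag_rel \<Gamma>"
    then have "raag_eq \<Gamma> (a @ b) (a' @ b')"
      by (metis (no_types) raag_rel_def mem_Collect_eq case_prod_conv raag_eq_words
          raag_eq.trans raag_eq_append_left raag_eq_append_right)
    with * show "raag_rel \<Gamma> `` {a @ b} = raag_rel \<Gamma> `` {a' @ b'}"
      by (subst raag_class_eq_iff) (auto simp: raag_rel_def dest: raag_eq_words)
  qed
  from UN_equiv_class2[OF equiv_raag_rel equiv_raag_rel this assms]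
  show ?thesis by (simp add: raag_def)
qed

lemma raag_carrierI: "w \<in> raag_words \<Gamma> \<Longrightarrow> raag_rel \<Gamma> `` {w} \<in> carrier (raag \<Gamma>)"
  by (simp add: raag_def quotientI)

lemma raag_carrierE:
  assumes "g \<in> carrier (raag \<Gamma>)"
  obtains w where "w \<in> raag_words \<Gamma>" "g = raag_rel \<Gamma> `` {w}"
  using assms by (auto simp: raag_def elim: quotientE)

definition word_inv :: "'a word \<Rightarrow> 'a word" where
  "word_inv w = rev (map (\<lambda>(v, b). (v, \<not> b)) w)"

lemma word_inv_words: "w \<in> raag_words \<Gamma> \<Longrightarrow> word_inv w \<in> raag_words \<Gamma>"
  by (induction w) (auto simp: word_inv_def)

lemma raag_eq_word_inv: "w \<in> raag_words \<Gamma> \<Longrightarrow> raag_eq \<Gamma> (word_inv w @ w) []"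
proof (induction w)
  case Nil
  then show ?case by (simp add: word_inv_def raag_eq.refl)
next
  case (Cons x w)
  obtain v b where x: "x = (v, b)" by (cases x)
  from Cons x have w: "word_inv w \<in> raag_words \<Gamma>" "w \<in> raag_words \<Gamma>" "v \<in> pverts \<Gamma>"
    using word_inv_words by auto
  have "word_inv (x # w) @ x # w = word_inv w @ [(v, \<not> b), (v, \<not> \<not> b)] @ w"
    by (simp add: x word_inv_def)
  moreover have "raag_eq \<Gamma> \<dots> (word_inv w @ w)"
    by (rule raag_eq.cancel) (simp add: w)
  ultimately show ?case
    using Cons.IH w(2) raag_eq.trans by metis
qed

lemma group_raag: "group (raag \<Gamma>)"
proof (rule groupI)
  have one: "\<one>\<^bsub>raag \<Gamma>\<^esub> = raag_rel \<Gamma> `` {[]}" by (simp add: raag_def)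
  show "\<one>\<^bsub>raag \<Gamma>\<^esub> \<in> carrier (raag \<Gamma>)"
    unfolding one by (rule raag_carrierI) simp
  fix x assume x: "x \<in> carrier (raag \<Gamma>)"
  then show "\<one>\<^bsub>raag \<Gamma>\<^esub> \<otimes>\<^bsub>raag \<Gamma>\<^esub> x = x"
    unfolding one by (auto elim!: raag_carrierE simp: raag_mult)
  from x obtain w where w: "w \<in> raag_words \<Gamma>" "x = raag_rel \<Gamma> `` {w}" by (rule raag_carrierE)
  then have "raag_rel \<Gamma> `` {word_inv w} \<otimes>\<^bsub>raag \<Gamma>\<^esub> x = \<one>\<^bsub>raag \<Gamma>\<^esub>"
    by (simp add: one raag_mult word_inv_words raag_class_eq_iff raag_eq_word_inv)
  with w show "\<exists>y\<in>carrier (raag \<Gamma>). y \<otimes>\<^bsub>raag \<Gamma>\<^esub> x = \<one>\<^bsub>raag \<Gamma>\<^esub>"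
    using raag_carrierI word_inv_words by blast
  fix y assume y: "y \<in> carrier (raag \<Gamma>)"
  with x show "x \<otimes>\<^bsub>raag \<Gamma>\<^esub> y \<in> carrier (raag \<Gamma>)"
    by (auto elim!: raag_carrierE simp: raag_mult intro!: raag_carrierI)
  fix z assume "z \<in> carrier (raag \<Gamma>)"
  with x y show "x \<otimes>\<^bsub>raag \<Gamma>\<^esub> y \<otimes>\<^bsub>raag \<Gamma>\<^esub> z = x \<otimes>\<^bsub>raag \<Gamma>\<^esub> (y \<otimes>\<^bsub>raag \<Gamma>\<^esub> z)"
    by (auto elim!: raag_carrierE simp: raag_mult)
qed

lemma raag_gen_closed: "v \<in> pverts \<Gamma> \<Longrightarrow> raag_gen \<Gamma> v \<in> carrier (raag \<Gamma>)"
  by (simp add: raag_gen_def raag_carrierI)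

lemma raag_gen_commute:
  assumes "u \<in> pverts \<Gamma>" "v \<in> pverts \<Gamma>" "(u, v) \<in> parcs \<Gamma>"
  shows "raag_gen \<Gamma> u \<otimes>\<^bsub>raag \<Gamma>\<^esub> raag_gen \<Gamma> v = raag_gen \<Gamma> v \<otimes>\<^bsub>raag \<Gamma>\<^esub> raag_gen \<Gamma> u"
  using assms raag_eq.commute[of "[]" u v "[]" \<Gamma>]
  by (simp add: raag_gen_def raag_mult raag_class_eq_iff)

lemma raag_gen_inv:
  assumes "v \<in> pverts \<Gamma>"
  shows "inv\<^bsub>raag \<Gamma>\<^esub> (raag_gen \<Gamma> v) = raag_rel \<Gamma> `` {[(v, False)]}"
proof (rule group.inv_equality[OF group_raag])
  have "raag_eq \<Gamma> [(v, False), (v, True)] []"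
    using raag_eq.cancel[of "[]" v False "[]" \<Gamma>] assms by simp
  then show "raag_rel \<Gamma> `` {[(v, False)]} \<otimes>\<^bsub>raag \<Gamma>\<^esub> raag_gen \<Gamma> v = \<one>\<^bsub>raag \<Gamma>\<^esub>"
    using assms by (simp add: raag_gen_def raag_mult raag_class_eq_iff) (simp add: raag_def raag_class_eq_iff)
qed (use assms in \<open>auto simp: raag_gen_def intro!: raag_carrierI\<close>)

lemma raag_generated: "generate (raag \<Gamma>) (raag_gen \<Gamma> ` pverts \<Gamma>) = carrier (raag \<Gamma>)"
proof
  interpret group "raag \<Gamma>" by (rule group_raag)
  show "generate (raag \<Gamma>) (raag_gen \<Gamma> ` pverts \<Gamma>) \<subseteq> carrier (raag \<Gamma>)"
    by (rule generate_incl) (auto intro: raag_gen_closed)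
  have "raag_rel \<Gamma> `` {w} \<in> generate (raag \<Gamma>) (raag_gen \<Gamma> ` pverts \<Gamma>)"
    if "w \<in> raag_words \<Gamma>" for w
    using that
  proof (induction w)
    case Nil
    show ?case using generate.one[of "raag \<Gamma>"] by (simp add: raag_def)
  next
    case (Cons x w)
    obtain v b where x: "x = (v, b)" by (cases x)
    from Cons.prems x have v: "v \<in> pverts \<Gamma>" and w: "w \<in> raag_words \<Gamma>" by auto
    have "raag_rel \<Gamma> `` {[x]} \<in> generate (raag \<Gamma>) (raag_gen \<Gamma> ` pverts \<Gamma>)"
    proof (cases b)
      case True
      then show ?thesis using v x by (auto simp: raag_gen_def intro!: generate.incl)
    next
      case False
      then show ?thesis using generate.inv[of "raag_gen \<Gamma> v" "raag_gen \<Gamma> ` pverts \<Gamma>" "raag \<Gamma>"] v x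
        by (simp add: raag_gen_inv)
    qed
    from generate.eng[OF this Cons.IH[OF w]] show ?case
      using v w x by (simp add: raag_mult)
  qed
  then show "carrier (raag \<Gamma>) \<subseteq> generate (raag \<Gamma>) (raag_gen \<Gamma> ` pverts \<Gamma>)"
    by (auto elim!: raag_carrierE)
qed

text \<open>Together with \<open>raag_gen_commute\<close> and \<open>raag_generated\<close>, the universal property of \<open>A(\<Gamma>)\<close>.\<close>

lemma raag_universal:
  fixes H (structure)
  assumes "group H" and f: "\<And>v. v \<in> pverts \<Gamma> \<Longrightarrow> f v \<in> carrier H"
    and comm: "\<And>u v. (u, v) \<in> parcs \<Gamma> \<Longrightarrow> f u \<otimes> f v = f v \<otimes> f u"
  shows "\<exists>h \<in> hom (raag \<Gamma>) H. \<forall>v\<in>pverts \<Gamma>. h (raag_gen \<Gamma> v) = f v"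
proof -
  interpret H: group H by fact
  define lt where "lt = (\<lambda>(v, b). if b then f v else inv (f v))"
  define ev where "ev w = foldr (\<lambda>x y. lt x \<otimes> y) w \<one>" for w
  have lt: "lt x \<in> carrier H" if "fst x \<in> pverts \<Gamma>" for x
    using that f by (cases x) (auto simp: lt_def)
  have ev_closed: "ev w \<in> carrier H" if "w \<in> raag_words \<Gamma>" for w
    using that by (induction w) (auto simp: ev_def lt)
  have ev_app: "ev (v @ w) = ev v \<otimes> ev w" if "v \<in> raag_words \<Gamma>" "w \<in> raag_words \<Gamma>" for v w
    using that
  proof (induction v)
    case Nil then show ?case using ev_closed[of w] by (simp add: ev_def)
  next
    case (Cons x v)
    have *: "ev (x # u) = lt x \<otimes> ev u" for u by (simp add: ev_def)
    show ?case using Cons ev_closed[of v] ev_closed[of w] lt[of x] by (simp add: * H.m_assoc)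
  qed
  have ev_eq: "ev w = ev w'" if "raag_eq \<Gamma> w w'" for w w'
    using that
  proof (induction rule: raag_eq.induct)
    case (cancel xs v b ys)
    then have "v \<in> pverts \<Gamma>" "xs \<in> raag_words \<Gamma>" "ys \<in> raag_words \<Gamma>" by auto
    moreover from this f have "ev [(v, b), (v, \<not> b)] = \<one>"
      by (cases b) (auto simp: ev_def lt_def)
    ultimately have "ev ([(v, b), (v, \<not> b)] @ ys) = ev ys"
      using ev_app[of "[(v, b), (v, \<not> b)]" ys] ev_closed[of ys] by simp
    then show ?case
      using ev_app[of xs "[(v, b), (v, \<not> b)] @ ys"] ev_app[of xs ys] cancel by simp
  next
    case (commute xs u v ys)
    then have *: "u \<in> pverts \<Gamma>" "v \<in> pverts \<Gamma>" "xs \<in> raag_words \<Gamma>" "ys \<in> raag_words \<Gamma>" by auto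
    have "ev [(u, True), (v, True)] = ev [(v, True), (u, True)]"
      using comm[OF commute(2)] f[of u] f[of v] * by (simp add: ev_def lt_def)
    then have "ev ([(u, True), (v, True)] @ ys) = ev ([(v, True), (u, True)] @ ys)"
      using ev_app[of "[(u, True), (v, True)]" ys] ev_app[of "[(v, True), (u, True)]" ys] *
      by simp
    then show ?case
      using ev_app[of xs "[(u, True), (v, True)] @ ys"] ev_app[of xs "[(v, True), (u, True)] @ ys"] *
      by simp
  qed auto
  define h where "h A = ev (SOME w. w \<in> A)" for A
  have h: "h (raag_rel \<Gamma> `` {w}) = ev w" if "w \<in> raag_words \<Gamma>" for w
  proof -
    have "w \<in> raag_rel \<Gamma> `` {w}" using that by (auto simp: raag_rel_def intro: raag_eq.refl)
    then have "(SOME w'. w' \<in> raag_rel \<Gamma> `` {w}) \<in> raag_rel \<Gamma> `` {w}" by (rule someI)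
    then show ?thesis unfolding h_def using ev_eq by (auto simp: raag_rel_def)
  qed
  have "h \<in> hom (raag \<Gamma>) H"
    by (rule homI) (auto elim!: raag_carrierE simp: raag_mult h ev_closed ev_app)
  moreover have "h (raag_gen \<Gamma> v) = f v" if "v \<in> pverts \<Gamma>" for v
    using that f by (simp add: raag_gen_def h ev_def lt_def)
  ultimately show ?thesis by blast
qed


section \<open>Word metrics\<close>

definition finite_generating_set :: "('a, 'b) monoid_scheme \<Rightarrow> 'a set \<Rightarrow> bool" where
  "finite_generating_set G S \<longleftrightarrow> finite S \<and> S \<subseteq> carrier G \<and> generate G S = carrier G"

definition word_length :: "('a, 'b) monoid_scheme \<Rightarrow> 'a set \<Rightarrow> 'a \<Rightarrow> nat" where
  "word_length G S g =
     (LEAST n. \<exists>xs. length xs = n \<and> set xs \<subseteq> S \<union> m_inv G ` S \<and> foldr (monoid.mult G) xs \<one>\<^bsub>G\<^esub> = g)"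

text \<open>
  The value outside of the carrier is irrelevant; it makes \<open>word_dist\<close> symmetric for all arguments, as
  the locale \<^locale>\<open>Metric_space\<close> demands.
\<close>

definition word_dist :: "('a, 'b) monoid_scheme \<Rightarrow> 'a set \<Rightarrow> 'a \<Rightarrow> 'a \<Rightarrow> real" where
  "word_dist G S g h =
     (if g \<in> carrier G \<and> h \<in> carrier G
      then real (word_length G S (inv\<^bsub>G\<^esub> g \<otimes>\<^bsub>G\<^esub> h)) else 0)"

lemma (in group) foldr_mult_closed: "set xs \<subseteq> carrier G \<Longrightarrow> foldr (monoid.mult G) xs \<one> \<in> carrier G"
  by (induction xs) auto

lemma (in group) foldr_mult_append:
  "set xs \<subseteq> carrier G \<Longrightarrow> set ys \<subseteq> carrier G \<Longrightarrow>
     foldr (monoid.mult G) (xs @ ys) \<one> = foldr (monoid.mult G) xs \<one> \<otimes> foldr (monoid.mult G) ys \<one>"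
  by (induction xs) (auto simp: foldr_mult_closed m_assoc simp del: foldr_append)

lemma (in group) foldr_mult_inv:
  "set xs \<subseteq> carrier G \<Longrightarrow>
     inv (foldr (monoid.mult G) xs \<one>) = foldr (monoid.mult G) (rev (map (m_inv G) xs)) \<one>"
proof (induction xs)
  case (Cons x xs)
  have "set (rev (map (m_inv G) xs)) \<subseteq> carrier G" "set [inv x] \<subseteq> carrier G"
    using Cons.prems by auto
  from foldr_mult_append[OF this] Cons show ?case
    by (simp add: foldr_mult_closed inv_mult_group del: foldr_append)
qed simp

lemma (in group) generate_word:
  assumes "S \<subseteq> carrier G" "g \<in> generate G S"
  shows "\<exists>xs. set xs \<subseteq> S \<union> m_inv G ` S \<and> foldr (monoid.mult G) xs \<one> = g"
  using assms(2)
proof (induction rule: generate.induct)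
  case one
  show ?case by (rule exI[of _ "[]"]) simp
next
  case (incl h)
  then show ?case using assms(1) by (intro exI[of _ "[h]"]) auto
next
  case (inv h)
  then show ?case using assms(1) by (intro exI[of _ "[inv h]"]) auto
next
  case (eng g h)
  then obtain xs ys where xy: "set xs \<subseteq> S \<union> m_inv G ` S" "foldr (monoid.mult G) xs \<one> = g"
    "set ys \<subseteq> S \<union> m_inv G ` S" "foldr (monoid.mult G) ys \<one> = h" by blast
  have "S \<union> m_inv G ` S \<subseteq> carrier G" using assms(1) by auto
  from foldr_mult_append[OF order_trans[OF xy(1) this] order_trans[OF xy(3) this]] xy
  show ?case by (intro exI[of _ "xs @ ys"]) (simp del: foldr_append)
qed

lemma (in group) word_length_le:
  assumes "set xs \<subseteq> S \<union> m_inv G ` S" "foldr (monoid.mult G) xs \<one> = g"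
  shows "word_length G S g \<le> length xs"
  unfolding word_length_def by (rule Least_le) (use assms in blast)

lemma (in group) word_length_attained:
  assumes "S \<subseteq> carrier G" "generate G S = carrier G" "g \<in> carrier G"
  obtains xs where "set xs \<subseteq> S \<union> m_inv G ` S" "foldr (monoid.mult G) xs \<one> = g"
    "length xs = word_length G S g"
proof -
  have "\<exists>n xs. length xs = n \<and> set xs \<subseteq> S \<union> m_inv G ` S \<and> foldr (monoid.mult G) xs \<one> = g"
    using generate_word[OF assms(1), of g] assms by auto
  from LeastI_ex[OF this] show ?thesis using that unfolding word_length_def by blast
qed

lemma (in group) Metric_space_word_dist:
  assumes "S \<subseteq> carrier G" "generate G S = carrier G"
  shows "Metric_space (carrier G) (word_dist G S)"
proof
  have sub: "S \<union> m_inv G ` S \<subseteq> carrier G" using assms(1) by auto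
  note att = word_length_attained[OF assms]
  have inv_le: "word_length G S (inv g) \<le> word_length G S g" if g: "g \<in> carrier G" for g
  proof -
    obtain xs where xs: "set xs \<subseteq> S \<union> m_inv G ` S" "foldr (monoid.mult G) xs \<one> = g"
      "length xs = word_length G S g" using att[OF g] .
    have "set (rev (map (m_inv G) xs)) \<subseteq> S \<union> m_inv G ` S"
    proof
      fix y assume "y \<in> set (rev (map (m_inv G) xs))"
      then obtain x where "x \<in> set xs" and y: "y = inv x" by auto
      then have "x \<in> S \<union> m_inv G ` S" using xs(1) by blast
      then show "y \<in> S \<union> m_inv G ` S"
      proof (elim UnE imageE)
        fix s assume "x = inv s" "s \<in> S"
        then show ?thesis using y assms(1) inv_inv[of s] by (simp add: subsetD)
      qed (simp add: y)
    qed
    from word_length_le[OF this, of "inv g"] foldr_mult_inv[OF order_trans[OF xs(1) sub]] xs(2,3)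
    show ?thesis by simp
  qed
  fix x y z
  show "0 \<le> word_dist G S x y" by (simp add: word_dist_def)
  show "word_dist G S x y = word_dist G S y x"
  proof (cases "x \<in> carrier G \<and> y \<in> carrier G")
    case False
    then show ?thesis by (auto simp: word_dist_def)
  next
    case True
    then have *: "inv x \<otimes> y \<in> carrier G" "inv y \<otimes> x \<in> carrier G"
      "inv (inv x \<otimes> y) = inv y \<otimes> x" "inv (inv y \<otimes> x) = inv x \<otimes> y"
      using inv_mult_group[of "inv x" y] inv_mult_group[of "inv y" x] by auto
    have "word_length G S (inv x \<otimes> y) = word_length G S (inv y \<otimes> x)"
      using inv_le[OF *(1)] inv_le[OF *(2)] unfolding *(3,4) by (rule order_antisym[rotated])
    with True show ?thesis by (simp add: word_dist_def)
  qed
  show "word_dist G S x y = 0 \<longleftrightarrow> x = y" if xy: "x \<in> carrier G" "y \<in> carrier G"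
  proof
    assume 0: "word_dist G S x y = 0"
    have "inv x \<otimes> y \<in> carrier G" using xy by simp
    then obtain xs where xs: "foldr (monoid.mult G) xs \<one> = inv x \<otimes> y"
      "length xs = word_length G S (inv x \<otimes> y)" using att by blast
    from xs(2) 0 xy have "xs = []" by (simp add: word_dist_def)
    with xs(1) have "inv x \<otimes> y = \<one>" by simp
    then have "inv y = inv x" using xy by (intro inv_equality) auto
    then show "x = y" using xy inv_inv by metis
  next
    assume "x = y"
    then show "word_dist G S x y = 0" using word_length_le[of "[]" S \<one>] xy by (simp add: word_dist_def)
  qed
  show "word_dist G S x z \<le> word_dist G S x y + word_dist G S y z"
    if xyz: "x \<in> carrier G" "y \<in> carrier G" "z \<in> carrier G"
  proof -
    have cl: "inv x \<otimes> y \<in> carrier G" "inv y \<otimes> z \<in> carrier G" using xyz by auto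
    obtain xs where xs: "set xs \<subseteq> S \<union> m_inv G ` S" "foldr (monoid.mult G) xs \<one> = inv x \<otimes> y"
      "length xs = word_length G S (inv x \<otimes> y)" using att[OF cl(1)] .
    obtain ys where ys: "set ys \<subseteq> S \<union> m_inv G ` S" "foldr (monoid.mult G) ys \<one> = inv y \<otimes> z"
      "length ys = word_length G S (inv y \<otimes> z)" using att[OF cl(2)] .
    have "(inv x \<otimes> y) \<otimes> (inv y \<otimes> z) = inv x \<otimes> z"
      using xyz m_assoc[of y "inv y" z] by (simp add: m_assoc)
    then have *: "foldr (monoid.mult G) (xs @ ys) \<one> = inv x \<otimes> z"
      using foldr_mult_append[OF order_trans[OF xs(1) sub] order_trans[OF ys(1) sub]] xs(2) ys(2)
      by (simp del: foldr_append)
    have "set (xs @ ys) \<subseteq> S \<union> m_inv G ` S" using xs(1) ys(1) by simp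
    from word_length_le[OF this *] xs(3) ys(3) xyz show ?thesis
      by (simp add: word_dist_def)
  qed
qed

lemma finite_generating_set_raag:
  "pair_graph \<Gamma> \<Longrightarrow> finite_generating_set (raag \<Gamma>) (raag_gen \<Gamma> ` pverts \<Gamma>)"
  using raag_generated[of \<Gamma>] raag_gen_closed[of _ \<Gamma>] pair_fin_digraph.pair_finite_verts[of \<Gamma>]
  by (auto simp: finite_generating_set_def pair_graph_def pair_digraph_def)


section \<open>Coarse separation\<close>

text \<open>
  A metric space is given by its carrier \<open>X\<close> and its distance \<open>d\<close>. The distance to a set is extended
  real valued, so that the distance to the empty set is \<open>\<infinity>\<close>.
\<close>

definition set_dist :: "('a \<Rightarrow> 'a \<Rightarrow> real) \<Rightarrow> 'a \<Rightarrow> 'a set \<Rightarrow> ereal" where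
  "set_dist d x Z = (INF z\<in>Z. ereal (d x z))"

definition thickening :: "'a set \<Rightarrow> ('a \<Rightarrow> 'a \<Rightarrow> real) \<Rightarrow> 'a set \<Rightarrow> real \<Rightarrow> 'a set" where
  "thickening X d Z L = {x \<in> X. set_dist d x Z \<le> ereal L}"

definition k_connected :: "('a \<Rightarrow> 'a \<Rightarrow> real) \<Rightarrow> real \<Rightarrow> 'a set \<Rightarrow> bool" where
  "k_connected d k A \<longleftrightarrow>
     (\<forall>x\<in>A. \<forall>y\<in>A. \<exists>xs. xs \<noteq> [] \<and> set xs \<subseteq> A \<and> hd xs = x \<and> last xs = y \<and>
        successively (\<lambda>u v. d u v \<le> k) xs)"

definition k_component :: "('a \<Rightarrow> 'a \<Rightarrow> real) \<Rightarrow> real \<Rightarrow> 'a set \<Rightarrow> 'a set \<Rightarrow> bool" where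
  "k_component d k Y C \<longleftrightarrow>
     C \<subseteq> Y \<and> k_connected d k C \<and> (\<forall>C'. C \<subseteq> C' \<and> C' \<subseteq> Y \<and> k_connected d k C' \<longrightarrow> C' = C)"

definition coarsely_separated_by ::
    "'a set \<Rightarrow> ('a \<Rightarrow> 'a \<Rightarrow> real) \<Rightarrow> 'a set set \<Rightarrow> bool" where
  "coarsely_separated_by X d \<Z> \<longleftrightarrow>
     (\<exists>k\<ge>0. \<exists>L\<ge>0. k_connected d k X \<and>
        (\<forall>D\<ge>0. \<exists>Z\<in>\<Z>. \<exists>C\<^sub>1 C\<^sub>2.
           k_component d k (X - thickening X d Z L) C\<^sub>1 \<and>
           k_component d k (X - thickening X d Z L) C\<^sub>2 \<and> C\<^sub>1 \<noteq> C\<^sub>2 \<and>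
           (\<exists>x\<in>C\<^sub>1. set_dist d x Z \<ge> ereal D) \<and> (\<exists>x\<in>C\<^sub>2. set_dist d x Z \<ge> ereal D)))"


section \<open>Growth\<close>

text \<open>
  In a bounded degree graph the cardinalities in question are bounded for each \<open>R\<close>, so the supremum
  is taken over a finite set of natural numbers; it is \<open>0\<close> if the family has no nonempty member, and
  then \<open>ln 0 = 0\<close> makes the growth subexponential.
\<close>

definition growth_fun :: "'a set \<Rightarrow> ('a \<Rightarrow> 'a \<Rightarrow> real) \<Rightarrow> 'a set set \<Rightarrow> real \<Rightarrow> nat" where
  "growth_fun X d \<S> R = Sup {card (Metric_space.mcball X d s R \<inter> S) | s S. S \<in> \<S> \<and> s \<in> S}"

definition exponential_growth :: "'a set \<Rightarrow> ('a \<Rightarrow> 'a \<Rightarrow> real) \<Rightarrow> 'a set set \<Rightarrow> bool" where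
  "exponential_growth X d \<S> \<longleftrightarrow>
     Limsup at_top (\<lambda>r::real. ereal (1 / r * ln (real (growth_fun X d \<S> r)))) > 0"

definition subexponential_growth :: "'a set \<Rightarrow> ('a \<Rightarrow> 'a \<Rightarrow> real) \<Rightarrow> 'a set set \<Rightarrow> bool" where
  "subexponential_growth X d \<S> \<longleftrightarrow> \<not> exponential_growth X d \<S>"

definition admits_subexp_separating_family ::
    "('a, 'b) monoid_scheme \<Rightarrow> 'a set \<Rightarrow> bool" where
  "admits_subexp_separating_family G S \<longleftrightarrow>
     (\<exists>\<Z>. (\<forall>Z\<in>\<Z>. Z \<subseteq> carrier G) \<and>
          coarsely_separated_by (carrier G) (word_dist G S) \<Z> \<and>
          subexponential_growth (carrier G) (word_dist G S) \<Z>)"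

end

theory Submission
  imports Defs
begin

text \<open>
The reason for the statement is that its hypothesis is contradictory: if \<open>\<Gamma>\<close> is unpinched, then no
family of subexponential growth coarsely separates \<open>A(\<Gamma>)\<close>. The argument is probabilistic and treats
all unpinched graphs at once, with or without triangles.

Let \<open>W\<close> be the right-angled Coxeter group of \<open>\<Gamma>\<close>. A reduced word \<open>u\<close> of \<open>W\<close> can be turned into an
element of \<open>A(\<Gamma>)\<close> by giving every letter a positive exponent between \<open>1\<close> and a constant \<open>N\<close>. If the
exponent of a letter depends only on its generator \<open>s\<close> and on the number of earlier occurrences of
\<open>s\<close> in \<open>u\<close>, then exchanging two adjacent commuting letters of \<open>u\<close> does not change the resulting
element. Hence each choice \<open>e\<close> of exponents gives a Lipschitz map \<open>\<phi>\<^sub>e\<close> from \<open>W\<close> to \<open>A(\<Gamma>)\<close>.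

Two facts make these maps useful. Since \<open>\<Gamma>\<close> is unpinched, \<open>W\<close> stays connected after removal of any
ball around \<open>1\<close> (\<open>word_connected_beyond\<close>): the letters that can be moved to the end of a reduced word
form a clique, and \<open>\<Gamma>\<close> minus that clique is connected. On the other hand the element \<open>\<phi>\<^sub>e(u)\<close> determines
the exponents of all letters of \<open>u\<close> (\<open>expand_inject\<close>). So for random exponents each
element of \<open>A(\<Gamma>)\<close> is equal to \<open>\<phi>\<^sub>e(u)\<close> with probability at most \<open>N\<^sup>-\<^sup>r\<close>, where \<open>r\<close> is the length of \<open>u\<close>.

Let \<open>Z\<close> belong to a family of subexponential growth. The number of elements near \<open>Z\<close> within a ball
whose radius is a multiple of \<open>r\<close> is at most a constant times \<open>2\<^sup>r\<close>, and there are at most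
\<open>card V\<^sup>r\<close> words of length \<open>r\<close>. For \<open>N = 8 card V\<close> a union bound (\<open>card_near_some_word\<close>) shows that, for given
\<open>p\<close> and large \<open>n\<close>, with high probability no \<open>p \<phi>\<^sub>e(u)\<close> with \<open>u\<close> of length at least \<open>n\<close> is
near \<open>Z\<close>; if \<open>p\<close> is far from \<open>Z\<close>, with high probability no \<open>p \<phi>\<^sub>e(u)\<close> at all is near \<open>Z\<close>.

Now let \<open>x\<close> and \<open>y\<close> be far from \<open>Z\<close> and join them by a path \<open>x = p\<^sub>0, \<dots>, p\<^sub>l = y\<close> in \<open>A(\<Gamma>)\<close>, which may well
meet \<open>Z\<close>. One and the same \<open>e\<close> is good for all the points \<open>p\<^sub>i\<close> if \<open>n\<close> is large compared with \<open>l\<close>.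
From \<open>x\<close> one gets to \<open>x \<phi>\<^sub>e(u)\<close> with \<open>u\<close> of length \<open>n\<close>, and likewise for \<open>y\<close>. For fixed \<open>i\<close> the points \<open>p\<^sub>i \<phi>\<^sub>e(u)\<close> with \<open>u\<close> of
length at least \<open>n\<close> are connected to each other. Finally, if \<open>p\<^sub>i\<^sub>+\<^sub>1\<close> and \<open>p\<^sub>i\<close> differ by a generator \<open>v\<close>, take \<open>u\<close> of length \<open>n\<close> in the
link of \<open>v\<close>, which exists because the link is not a clique; then \<open>v\<close> commutes with \<open>\<phi>\<^sub>e(u)\<close>, so that
\<open>p\<^sub>i \<phi>\<^sub>e(u)\<close> and \<open>p\<^sub>i\<^sub>+\<^sub>1 \<phi>\<^sub>e(u)\<close> are adjacent. All this happens away from \<open>Z\<close>, so \<open>x\<close> and \<open>y\<close> lie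
in the same component (\<open>far_points_linked\<close>).
\<close>

section \<open>Unpinched graphs\<close>

lemma pair_graph_adj:
  assumes "pair_graph \<Gamma>"
  shows "finite (pverts \<Gamma>)"
    and "(u, v) \<in> parcs \<Gamma> \<Longrightarrow> u \<in> pverts \<Gamma> \<and> v \<in> pverts \<Gamma> \<and> u \<noteq> v \<and> (v, u) \<in> parcs \<Gamma>"
proof -
  interpret pair_graph \<Gamma> by fact
  show "finite (pverts \<Gamma>)" by (rule pair_finite_verts)
  assume uv: "(u, v) \<in> parcs \<Gamma>"
  then show "u \<in> pverts \<Gamma> \<and> v \<in> pverts \<Gamma> \<and> u \<noteq> v \<and> (v, u) \<in> parcs \<Gamma>"
    using in_arcsD1[OF uv] in_arcsD2[OF uv] pair_no_loops[OF uv] arcs_symmetric[OF uv] by simp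
qed

lemma unpinched_connected_minus_clique:
  assumes "pair_graph \<Gamma>" "unpinched \<Gamma>" "is_clique \<Gamma> C"
    and "u \<in> pverts \<Gamma> - C" "v \<in> pverts \<Gamma> - C"
  shows "(u, v) \<in> (Restr (parcs \<Gamma>) (pverts \<Gamma> - C))\<^sup>*"
proof -
  let ?H = "induce_subgraph (with_proj \<Gamma>) (pverts \<Gamma> - C)"
  have "Digraph_Component.connected ?H"
    using assms(2,3) by (auto simp: unpinched_def separated_by_clique_def)
  then have "reachable (with_proj (mk_symmetric ?H)) u v"
    using assms(4,5) by (auto simp: connected_def strongly_connected_def)
  from reachable_rtranclI[OF this] have reach: "(u, v) \<in> (parcs (mk_symmetric ?H))\<^sup>*"
    by simp
  have "parcs (mk_symmetric ?H) \<subseteq> Restr (parcs \<Gamma>) (pverts \<Gamma> - C)"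
    using pair_graph_adj(2)[OF assms(1)]
    by (auto simp: parcs_mk_symmetric arcs_ends_conv)
  from rtrancl_mono[OF this] reach show ?thesis by (rule subsetD)
qed

lemma unpinched_minus_clique_nonempty:
  assumes "unpinched \<Gamma>" "is_clique \<Gamma> C"
  obtains v where "v \<in> pverts \<Gamma>" "v \<notin> C"
  using assms by (auto simp: unpinched_def complete_graph_def is_clique_def)

text \<open>
If the link of \<open>v\<close> were a clique, it would separate \<open>v\<close> from every vertex outside its star.
\<close>

lemma unpinched_link_not_clique:
  assumes G: "pair_graph \<Gamma>" and U: "unpinched \<Gamma>" and v: "v \<in> pverts \<Gamma>"
  obtains a b where "(v, a) \<in> parcs \<Gamma>" "(v, b) \<in> parcs \<Gamma>" "a \<noteq> b" "(a, b) \<notin> parcs \<Gamma>"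
proof -
  let ?L = "{a. (v, a) \<in> parcs \<Gamma>}"
  note adj = pair_graph_adj(2)[OF G]
  have "\<not> is_clique \<Gamma> ?L"
  proof
    assume L: "is_clique \<Gamma> ?L"
    then have "is_clique \<Gamma> (insert v ?L)"
      using v adj unfolding is_clique_def by blast
    then obtain w where w: "w \<in> pverts \<Gamma>" "w \<noteq> v" "w \<notin> ?L"
      using unpinched_minus_clique_nonempty[OF U] by blast
    have "(v, w) \<in> (Restr (parcs \<Gamma>) (pverts \<Gamma> - ?L))\<^sup>*"
      using unpinched_connected_minus_clique[OF G U L] v w adj by blast
    then show False using w(2) by (cases rule: converse_rtranclE) auto
  qed
  then show thesis using that adj unfolding is_clique_def by blast
qed

section \<open>Reduced words of the right-angled Coxeter group\<close>

text \<open>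
Words are read from right to left: the head of a list is the last letter, so that multiplying on
the right is \<open>Cons\<close>. The descents of a word are the letters that can be moved to its end by commutations,
and a word is reduced if no letter can be moved next to another copy of itself. By Tits' solution of
the word problem, reduced words up to commutations are the elements of the right-angled Coxeter
group; working with the words themselves makes it unnecessary to introduce that group.
\<close>

fun descents :: "'a rel \<Rightarrow> 'a list \<Rightarrow> 'a set" where
  "descents E [] = {}"
| "descents E (s # u) = insert s {t \<in> descents E u. (t, s) \<in> E}"

fun reduced :: "'a rel \<Rightarrow> 'a list \<Rightarrow> bool" where
  "reduced E [] \<longleftrightarrow> True"
| "reduced E (s # u) \<longleftrightarrow> s \<notin> descents E u \<and> reduced E u"

definition reduced_words :: "'a pair_pre_digraph \<Rightarrow> nat \<Rightarrow> nat \<Rightarrow> 'a list set" where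
  "reduced_words \<Gamma> n m =
     {u. set u \<subseteq> pverts \<Gamma> \<and> reduced (parcs \<Gamma>) u \<and> n \<le> length u \<and> length u \<le> m}"

text \<open>
Paths in the part of the Cayley graph of the Coxeter group that lies between the spheres of radius
\<open>n\<close> and \<open>m\<close>. The upper bound \<open>m\<close> keeps the set of words finite, so that finitely many exponents have
to be chosen later on.
\<close>

inductive word_connected :: "'a pair_pre_digraph \<Rightarrow> nat \<Rightarrow> nat \<Rightarrow> 'a list \<Rightarrow> 'a list \<Rightarrow> bool"
  for \<Gamma> n m where
  refl: "u \<in> reduced_words \<Gamma> n m \<Longrightarrow> word_connected \<Gamma> n m u u"
| sym: "word_connected \<Gamma> n m u v \<Longrightarrow> word_connected \<Gamma> n m v u"
| trans: "word_connected \<Gamma> n m u v \<Longrightarrow> word_connected \<Gamma> n m v w \<Longrightarrow> word_connected \<Gamma> n m u w"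
| push: "u \<in> reduced_words \<Gamma> n m \<Longrightarrow> s # u \<in> reduced_words \<Gamma> n m \<Longrightarrow>
    word_connected \<Gamma> n m u (s # u)"
| swap: "xs @ s # t # ys \<in> reduced_words \<Gamma> n m \<Longrightarrow> (s, t) \<in> parcs \<Gamma> \<Longrightarrow>
    word_connected \<Gamma> n m (xs @ s # t # ys) (xs @ t # s # ys)"

lemma descents_clique:
  assumes "pair_graph \<Gamma>" "set u \<subseteq> pverts \<Gamma>"
  shows "is_clique \<Gamma> (descents (parcs \<Gamma>) u)"
  using assms(2)
proof (induction u)
  case (Cons s u)
  then have C: "is_clique \<Gamma> (descents (parcs \<Gamma>) u)" and s: "s \<in> pverts \<Gamma>" by auto
  have "(s, t) \<in> parcs \<Gamma>" if "(t, s) \<in> parcs \<Gamma>" for t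
    using pair_graph_adj(2)[OF assms(1) that] by simp
  with C s show ?case unfolding is_clique_def descents.simps by blast
qed (simp add: is_clique_def)

lemma descents_swap:
  assumes "pair_graph \<Gamma>" "(s, t) \<in> parcs \<Gamma>"
  shows "descents (parcs \<Gamma>) (xs @ s # t # ys) = descents (parcs \<Gamma>) (xs @ t # s # ys)"
proof -
  have "(t, s) \<in> parcs \<Gamma>" using pair_graph_adj(2)[OF assms] by simp
  with assms(2) show ?thesis by (induction xs) auto
qed

lemma reduced_swap:
  assumes "pair_graph \<Gamma>" "(s, t) \<in> parcs \<Gamma>"
  shows "reduced (parcs \<Gamma>) (xs @ s # t # ys) \<longleftrightarrow> reduced (parcs \<Gamma>) (xs @ t # s # ys)"
proof (induction xs)
  case Nil
  then show ?case using pair_graph_adj(2)[OF assms] assms(2) by auto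
next
  case (Cons x xs)
  then show ?case using descents_swap[OF assms, of xs ys] by simp
qed

lemma reduced_words_swap:
  assumes "pair_graph \<Gamma>" "(s, t) \<in> parcs \<Gamma>" "xs @ s # t # ys \<in> reduced_words \<Gamma> n m"
  shows "xs @ t # s # ys \<in> reduced_words \<Gamma> n m"
  using assms(3) reduced_swap[OF assms(1,2)] by (simp add: reduced_words_def insert_commute)

lemma word_connected_reduced:
  assumes "pair_graph \<Gamma>" "word_connected \<Gamma> n m u v"
  shows "u \<in> reduced_words \<Gamma> n m \<and> v \<in> reduced_words \<Gamma> n m"
  using assms(2) by induction (auto intro: reduced_words_swap[OF assms(1)])

text \<open>
Connectedness of \<open>\<Gamma>\<close> minus a clique enters here: \<open>us\<close> and \<open>ut\<close> are joined by following a path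
\<open>s = x\<^sub>0, x\<^sub>1, \<dots>, x\<^sub>k = t\<close> of \<open>\<Gamma>\<close> that avoids the clique of descents of \<open>u\<close>. Since \<open>x\<^sub>i\<close> and \<open>x\<^sub>i\<^sub>+\<^sub>1\<close> commute,
the words \<open>ux\<^sub>i\<close>, \<open>ux\<^sub>ix\<^sub>i\<^sub>+\<^sub>1 = ux\<^sub>i\<^sub>+\<^sub>1x\<^sub>i\<close>, \<open>ux\<^sub>i\<^sub>+\<^sub>1\<close> form a path outside the ball of radius \<open>n\<close>.
\<close>

lemma word_connected_pushes:
  assumes G: "pair_graph \<Gamma>" and U: "unpinched \<Gamma>"
    and u: "u \<in> reduced_words \<Gamma> n n" and m: "n + 2 \<le> m"
    and st: "s # u \<in> reduced_words \<Gamma> (n + 1) m" "t # u \<in> reduced_words \<Gamma> (n + 1) m"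
  shows "word_connected \<Gamma> (n + 1) m (s # u) (t # u)"
proof -
  let ?C = "descents (parcs \<Gamma>) u"
  note adj = pair_graph_adj(2)[OF G]
  have red: "x # u \<in> reduced_words \<Gamma> (n + 1) m" if "x \<in> pverts \<Gamma> - ?C" for x
    using that u m by (auto simp: reduced_words_def)
  have "is_clique \<Gamma> ?C"
    using descents_clique[OF G] u by (simp add: reduced_words_def)
  moreover have "s \<in> pverts \<Gamma> - ?C" "t \<in> pverts \<Gamma> - ?C"
    using st by (auto simp: reduced_words_def)
  ultimately have "(s, t) \<in> (Restr (parcs \<Gamma>) (pverts \<Gamma> - ?C))\<^sup>*"
    by (rule unpinched_connected_minus_clique[OF G U])
  then show ?thesis
  proof induction
    case base
    show ?case by (rule word_connected.refl) (rule st)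
  next
    case (step x y)
    then have x: "x \<in> pverts \<Gamma> - ?C" and y: "y \<in> pverts \<Gamma> - ?C" and xy: "(x, y) \<in> parcs \<Gamma>"
      by auto
    have yxu: "y # x # u \<in> reduced_words \<Gamma> (n + 1) m"
      using x y adj[OF xy] u m by (auto simp: reduced_words_def)
    then have xyu: "x # y # u \<in> reduced_words \<Gamma> (n + 1) m"
      using reduced_words_swap[OF G, of y x "[]"] adj[OF xy] by simp
    have "word_connected \<Gamma> (n + 1) m (x # u) (y # x # u)"
      by (rule word_connected.push[OF red[OF x] yxu])
    moreover have "word_connected \<Gamma> (n + 1) m (y # x # u) (x # y # u)"
      using word_connected.swap[of "[]" y x u] yxu adj[OF xy] by simp
    moreover have "word_connected \<Gamma> (n + 1) m (y # u) (x # y # u)"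
      by (rule word_connected.push[OF red[OF y] xyu])
    ultimately show ?case
      using step.IH word_connected.trans word_connected.sym by metis
  qed
qed

text \<open>
The words that replace \<open>u\<close> when a path is pushed off the sphere of radius \<open>n\<close>.
\<close>

definition lifts_of :: "nat \<Rightarrow> 'a list \<Rightarrow> 'a list set" where
  "lifts_of n u = (if length u \<le> n then {s # u | s. True} else {u})"

text \<open>
A path outside the open ball of radius \<open>n\<close> is pushed off the sphere of radius \<open>n\<close> word by word:
a word of length \<open>n\<close> on the path has a longer neighbour, and any two such neighbours are connected by
the preceding lemma.
\<close>

lemma word_connected_lifts:
  assumes G: "pair_graph \<Gamma>" and U: "unpinched \<Gamma>" and m: "n + 2 \<le> m"
    and uv: "word_connected \<Gamma> n m u v"
  shows "\<lbrakk>u' \<in> lifts_of n u; u' \<in> reduced_words \<Gamma> (n + 1) m;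
    v' \<in> lifts_of n v; v' \<in> reduced_words \<Gamma> (n + 1) m\<rbrakk>
      \<Longrightarrow> word_connected \<Gamma> (n + 1) m u' v'"
  using uv
proof (induction arbitrary: u' v')
  case (refl u)
  show ?case
  proof (cases "length u \<le> n")
    case True
    with refl have "u \<in> reduced_words \<Gamma> n n" by (simp add: reduced_words_def)
    from word_connected_pushes[OF G U this m] refl True show ?thesis
      by (auto simp: lifts_of_def)
  next
    case False
    with refl show ?thesis by (auto simp: lifts_of_def intro: word_connected.refl)
  qed
next
  case (sym u v)
  then show ?case by (blast intro: word_connected.sym)
next
  case (trans u v w)
  have v: "v \<in> reduced_words \<Gamma> n m" using word_connected_reduced[OF G trans.hyps(1)] by simp
  obtain v0 where "v0 \<in> lifts_of n v" "v0 \<in> reduced_words \<Gamma> (n + 1) m"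
  proof (cases "length v \<le> n")
    case True
    obtain s where "s \<in> pverts \<Gamma>" "s \<notin> descents (parcs \<Gamma>) v"
      using unpinched_minus_clique_nonempty[OF U descents_clique[OF G, of v]] v
      by (auto simp: reduced_words_def)
    then show thesis using that[of "s # v"] True v m by (auto simp: lifts_of_def reduced_words_def)
  next
    case False
    then show thesis using that[of v] v by (auto simp: lifts_of_def reduced_words_def)
  qed
  then show ?case using trans by (blast intro: word_connected.trans)
next
  case (push u s)
  show ?case
  proof (cases "length u \<le> n")
    case True
    with push have "u \<in> reduced_words \<Gamma> n n" "v' = s # u" by (auto simp: reduced_words_def lifts_of_def)
    from word_connected_pushes[OF G U this(1) m] this(2) push True show ?thesis
      by (auto simp: lifts_of_def)
  next
    case False
    then have "u' = u" "v' = s # u" using push by (auto simp: lifts_of_def)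
    then show ?thesis using push by (auto intro: word_connected.push)
  qed
next
  case (swap xs s t ys)
  let ?u = "xs @ s # t # ys" and ?v = "xs @ t # s # ys"
  show ?case
  proof (cases "length ?u \<le> n")
    case True
    then obtain a b where ab: "u' = a # ?u" "v' = b # ?v" using swap.prems by (auto simp: lifts_of_def)
    have av: "a # ?v \<in> reduced_words \<Gamma> (n + 1) m"
      using reduced_words_swap[OF G swap(2), of "a # xs" ys] swap.prems ab by simp
    have "?v \<in> reduced_words \<Gamma> n n"
      using reduced_words_swap[OF G swap(2,1)] True by (simp add: reduced_words_def)
    from word_connected_pushes[OF G U this m av] ab swap.prems
    have "word_connected \<Gamma> (n + 1) m (a # ?v) v'" by simp
    moreover have "word_connected \<Gamma> (n + 1) m u' (a # ?v)"
      using word_connected.swap[of "a # xs" s t ys] swap ab by simp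
    ultimately show ?thesis by (blast intro: word_connected.trans)
  next
    case False
    then have "u' = ?u" "v' = ?v" using swap by (auto simp: lifts_of_def)
    then show ?thesis using swap by (auto intro: word_connected.swap)
  qed
qed

text \<open>
Complements of balls are connected: for \<open>n = 0\<close> all words lead down to the empty one, and the path
obtained for \<open>n\<close> is pushed off the sphere of radius \<open>n\<close>.
\<close>

theorem word_connected_beyond:
  assumes G: "pair_graph \<Gamma>" and U: "unpinched \<Gamma>"
    and m: "n < m" and uv: "u \<in> reduced_words \<Gamma> n m" "v \<in> reduced_words \<Gamma> n m"
  shows "word_connected \<Gamma> n m u v"
  using m uv
proof (induction n arbitrary: u v)
  case 0
  have "word_connected \<Gamma> 0 m [] w" if "w \<in> reduced_words \<Gamma> 0 m" for w
    using that
  proof (induction w)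
    case Nil
    then show ?case by (rule word_connected.refl)
  next
    case (Cons s w)
    then have w: "w \<in> reduced_words \<Gamma> 0 m" by (simp add: reduced_words_def)
    from word_connected.trans[OF Cons.IH[OF w] word_connected.push[OF w Cons.prems]]
    show ?case .
  qed
  then show ?case using 0 by (blast intro: word_connected.trans word_connected.sym)
next
  case (Suc n)
  then have "word_connected \<Gamma> n m u v" by (simp add: reduced_words_def)
  from word_connected_lifts[OF G U _ this, of u v] Suc.prems show ?case
    by (auto simp: lifts_of_def reduced_words_def)
qed

section \<open>Random images of reduced words in the Artin group\<close>

definition raag_monomial :: "'a pair_pre_digraph \<Rightarrow> 'a list \<Rightarrow> 'a word set" where
  "raag_monomial \<Gamma> x = raag_rel \<Gamma> `` {map (\<lambda>v. (v, True)) (rev x)}"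

text \<open>
The index \<open>(s, j)\<close> refers to the letter \<open>s\<close> that has exactly \<open>j\<close> earlier occurrences of \<open>s\<close>. This
labelling of the letters of a word is invariant under commutations, and it gives different labels
to different letters of one word. The monomial of \<open>expand e u\<close> is the element \<open>\<phi>\<^sub>e(u)\<close> of the introduction.
\<close>

fun expand :: "('a \<times> nat \<Rightarrow> nat) \<Rightarrow> 'a list \<Rightarrow> 'a list" where
  "expand e [] = []"
| "expand e (s # u) = replicate (e (s, count_list u s)) s @ expand e u"

lemma set_expand: "set (expand e u) \<subseteq> set u"
  by (induction u) auto

lemma map_True_words: "map (\<lambda>v. (v, True)) x \<in> raag_words \<Gamma> \<longleftrightarrow> set x \<subseteq> pverts \<Gamma>"
  by (induction x) auto

lemma raag_monomial_closed:
  "set x \<subseteq> pverts \<Gamma> \<Longrightarrow> raag_monomial \<Gamma> x \<in> carrier (raag \<Gamma>)"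
  unfolding raag_monomial_def by (rule raag_carrierI) (simp add: map_True_words)

lemma raag_monomial_Nil: "raag_monomial \<Gamma> [] = \<one>\<^bsub>raag \<Gamma>\<^esub>"
  by (simp add: raag_monomial_def raag_def)

lemma raag_monomial_append:
  assumes "set x \<subseteq> pverts \<Gamma>" "set y \<subseteq> pverts \<Gamma>"
  shows "raag_monomial \<Gamma> (y @ x) = raag_monomial \<Gamma> x \<otimes>\<^bsub>raag \<Gamma>\<^esub> raag_monomial \<Gamma> y"
  using assms by (simp add: raag_monomial_def raag_mult map_True_words)

lemma raag_monomial_commute:
  assumes G: "pair_graph \<Gamma>" and v: "\<forall>t\<in>set x. \<forall>s\<in>set y. (s, t) \<in> parcs \<Gamma>"
    and x: "set x \<subseteq> pverts \<Gamma>" "set y \<subseteq> pverts \<Gamma>"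
  shows "raag_monomial \<Gamma> (x @ y) = raag_monomial \<Gamma> (y @ x)"
proof -
  interpret A: group "raag \<Gamma>" by (rule group_raag)
  let ?m = "raag_monomial \<Gamma>"
  note closed = raag_monomial_closed[of _ \<Gamma>] and app = raag_monomial_append[of _ \<Gamma>]
  have single: "?m [s] \<otimes>\<^bsub>raag \<Gamma>\<^esub> ?m [t] = ?m [t] \<otimes>\<^bsub>raag \<Gamma>\<^esub> ?m [s]" if "(s, t) \<in> parcs \<Gamma>" for s t
    using raag_gen_commute[of s \<Gamma> t] pair_graph_adj(2)[OF G that] that
    by (simp add: raag_monomial_def raag_gen_def)
  have left: "?m [s] \<otimes>\<^bsub>raag \<Gamma>\<^esub> ?m x = ?m x \<otimes>\<^bsub>raag \<Gamma>\<^esub> ?m [s]"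
    if "\<forall>t\<in>set x. (s, t) \<in> parcs \<Gamma>" "set x \<subseteq> pverts \<Gamma>" "s \<in> pverts \<Gamma>" for s x
    using that
  proof (induction x)
    case Nil
    then show ?case by (simp add: raag_monomial_Nil closed)
  next
    case (Cons t x)
    then have cl: "?m [s] \<in> carrier (raag \<Gamma>)" "?m [t] \<in> carrier (raag \<Gamma>)" "?m x \<in> carrier (raag \<Gamma>)"
      by (auto intro: closed)
    have tx: "?m (t # x) = ?m x \<otimes>\<^bsub>raag \<Gamma>\<^esub> ?m [t]" using app[of x "[t]"] Cons.prems by simp
    have IH: "?m [s] \<otimes>\<^bsub>raag \<Gamma>\<^esub> ?m x = ?m x \<otimes>\<^bsub>raag \<Gamma>\<^esub> ?m [s]" using Cons by simp
    have st: "?m [s] \<otimes>\<^bsub>raag \<Gamma>\<^esub> ?m [t] = ?m [t] \<otimes>\<^bsub>raag \<Gamma>\<^esub> ?m [s]" using single[of s t] Cons.prems by simp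
    show ?case unfolding tx
      by (metis A.m_assoc IH st cl)
  qed
  show ?thesis using v x
  proof (induction y)
    case (Cons s y)
    then have cl: "?m [s] \<in> carrier (raag \<Gamma>)" "?m x \<in> carrier (raag \<Gamma>)" "?m y \<in> carrier (raag \<Gamma>)"
      by (auto intro: closed)
    have s: "?m [s] \<otimes>\<^bsub>raag \<Gamma>\<^esub> ?m x = ?m x \<otimes>\<^bsub>raag \<Gamma>\<^esub> ?m [s]" using left[of x s] Cons.prems by auto
    have IH: "?m y \<otimes>\<^bsub>raag \<Gamma>\<^esub> ?m x = ?m x \<otimes>\<^bsub>raag \<Gamma>\<^esub> ?m y"
      using Cons app[of x y] app[of y x] by simp
    have sy: "?m (s # y) = ?m y \<otimes>\<^bsub>raag \<Gamma>\<^esub> ?m [s]" using app[of y "[s]"] Cons.prems by simp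
    have "?m (x @ s # y) = ?m (s # y) \<otimes>\<^bsub>raag \<Gamma>\<^esub> ?m x"
      "?m ((s # y) @ x) = ?m x \<otimes>\<^bsub>raag \<Gamma>\<^esub> ?m (s # y)"
      using app[of "s # y" x] app[of x "s # y"] Cons.prems by auto
    then show ?case unfolding sy by (metis A.m_assoc IH s cl)
  qed simp
qed

lemma expand_swap:
  assumes G: "pair_graph \<Gamma>" and st: "(s, t) \<in> parcs \<Gamma>" and V: "set (xs @ s # t # ys) \<subseteq> pverts \<Gamma>"
  shows "raag_monomial \<Gamma> (expand e (xs @ s # t # ys)) = raag_monomial \<Gamma> (expand e (xs @ t # s # ys))"
  using V
proof (induction xs)
  case Nil
  have ne: "s \<noteq> t" using pair_graph_adj(2)[OF G st] by simp
  let ?S = "replicate (e (s, count_list ys s)) s" and ?T = "replicate (e (t, count_list ys t)) t"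
  have sub: "set ?S \<subseteq> pverts \<Gamma>" "set ?T \<subseteq> pverts \<Gamma>" "set (expand e ys) \<subseteq> pverts \<Gamma>"
    using Nil set_expand[of e ys] by auto
  have "raag_monomial \<Gamma> (?T @ ?S) = raag_monomial \<Gamma> (?S @ ?T)"
    by (rule raag_monomial_commute[OF G]) (use st sub in auto)
  then show ?case
    using ne sub raag_monomial_append[of "expand e ys" \<Gamma> "?S @ ?T"]
      raag_monomial_append[of "expand e ys" \<Gamma> "?T @ ?S"] by auto
next
  case (Cons x xs)
  let ?X = "replicate (e (x, count_list (xs @ s # t # ys) x)) x"
  have "set ?X \<subseteq> pverts \<Gamma>" "set (expand e (xs @ s # t # ys)) \<subseteq> pverts \<Gamma>"
    "set (expand e (xs @ t # s # ys)) \<subseteq> pverts \<Gamma>"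
    using Cons.prems set_expand[of e "xs @ s # t # ys"] set_expand[of e "xs @ t # s # ys"] by auto
  moreover have "count_list (xs @ t # s # ys) x = count_list (xs @ s # t # ys) x" by auto
  ultimately show ?case
    using Cons raag_monomial_append[of "expand e (xs @ s # t # ys)" \<Gamma> ?X]
      raag_monomial_append[of "expand e (xs @ t # s # ys)" \<Gamma> ?X]
    by (simp del: count_list_append)
qed

section \<open>The image of a reduced word determines its exponents\<close>

text \<open>
For a fixed vertex \<open>s\<close>, the link of \<open>s\<close> acts trivially on the real line, \<open>s\<close> acts by \<open>x \<mapsto> 2x + 1\<close>
and all other generators act by \<open>x \<mapsto> 2x\<close>. This respects the relations of \<open>A(\<Gamma>)\<close>, because the
generators that commute with \<open>s\<close> are trivial and the other ones act by the same map. As these two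
affine maps generate a free monoid, the action remembers where \<open>s\<close> stands in a
positive word, relative to the letters that do not commute with it.
\<close>

fun letter_map :: "'a rel \<Rightarrow> 'a \<Rightarrow> 'a \<times> bool \<Rightarrow> real \<Rightarrow> real" where
  "letter_map E s (v, b) x =
     (if (s, v) \<in> E then x
      else if v = s then (if b then 2 * x + 1 else (x - 1) / 2)
      else (if b then 2 * x else x / 2))"

definition word_map :: "'a rel \<Rightarrow> 'a \<Rightarrow> 'a word \<Rightarrow> real \<Rightarrow> real" where
  "word_map E s w = foldr (letter_map E s) w"

lemma word_map_raag_eq:
  assumes G: "pair_graph \<Gamma>"
  shows "raag_eq \<Gamma> w w' \<Longrightarrow> word_map (parcs \<Gamma>) s w = word_map (parcs \<Gamma>) s w'"
proof (induction rule: raag_eq.induct)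
  case (cancel xs v b ys)
  have "letter_map (parcs \<Gamma>) s (v, b) (letter_map (parcs \<Gamma>) s (v, \<not> b) x) = x" for x
    by (cases b) (auto simp: field_simps)
  then show ?case by (simp add: word_map_def fun_eq_iff del: letter_map.simps)
next
  case (commute xs u v ys)
  have "u \<noteq> v" "(v, u) \<in> parcs \<Gamma>" using pair_graph_adj(2)[OF G commute(2)] by auto
  then have "letter_map (parcs \<Gamma>) s (u, True) (letter_map (parcs \<Gamma>) s (v, True) x)
      = letter_map (parcs \<Gamma>) s (v, True) (letter_map (parcs \<Gamma>) s (u, True) x)" for x
    using commute(2) by auto
  then show ?case by (simp add: word_map_def fun_eq_iff del: letter_map.simps)
qed auto

definition trace_bits :: "'a rel \<Rightarrow> 'a \<Rightarrow> 'a list \<Rightarrow> bool list" where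
  "trace_bits E s x = map (\<lambda>v. v = s) (filter (\<lambda>v. (s, v) \<notin> E) x)"

text \<open>
The image of \<open>1\<close> under \<open>x \<mapsto> 2x + b\<close> for all digits \<open>b\<close>; starting from \<open>1\<close> instead of \<open>0\<close> puts a leading
digit in front, which prevents the loss of leading zeros.
\<close>

fun binary_value :: "bool list \<Rightarrow> nat" where
  "binary_value [] = 1"
| "binary_value (b # bs) = 2 * binary_value bs + of_bool b"

lemma binary_value_pos: "binary_value bs > 0"
  by (induction bs) auto

lemma binary_value_inject: "binary_value bs = binary_value cs \<Longrightarrow> bs = cs"
proof (induction bs arbitrary: cs)
  case Nil
  then show ?case
  proof (cases cs)
    case (Cons c cs')
    then show ?thesis using Nil binary_value_pos[of cs'] by auto
  qed simp
next
  case (Cons b bs)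
  show ?case
  proof (cases cs)
    case Nil
    then show ?thesis using Cons.prems binary_value_pos[of bs] by auto
  next
    case cs: (Cons c cs')
    have "2 * binary_value bs + of_bool b = 2 * binary_value cs' + of_bool c"
      using Cons.prems cs by simp
    then have "b = c" "binary_value bs = binary_value cs'"
      by (cases b; cases c; simp; presburger)+
    then show ?thesis using Cons.IH cs by simp
  qed
qed

lemma word_map_positive:
  "word_map E s (map (\<lambda>v. (v, True)) x) 1 = real (binary_value (trace_bits E s x))"
  by (induction x) (auto simp: word_map_def trace_bits_def)

lemma raag_monomial_trace_bits:
  assumes G: "pair_graph \<Gamma>" and x: "set x \<subseteq> pverts \<Gamma>" "set y \<subseteq> pverts \<Gamma>"
    and eq: "raag_monomial \<Gamma> x = raag_monomial \<Gamma> y"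
  shows "trace_bits (parcs \<Gamma>) s x = trace_bits (parcs \<Gamma>) s y"
proof -
  have "raag_eq \<Gamma> (map (\<lambda>v. (v, True)) (rev x)) (map (\<lambda>v. (v, True)) (rev y))"
    using eq x by (simp add: raag_monomial_def raag_class_eq_iff map_True_words)
  from fun_cong[OF word_map_raag_eq[OF G this, of s], of 1]
  have "binary_value (trace_bits (parcs \<Gamma>) s (rev x)) = binary_value (trace_bits (parcs \<Gamma>) s (rev y))"
    by (simp only: word_map_positive of_nat_eq_iff)
  then have "trace_bits (parcs \<Gamma>) s (rev x) = trace_bits (parcs \<Gamma>) s (rev y)"
    by (rule binary_value_inject)
  moreover have "trace_bits E s (rev z) = rev (trace_bits E s z)" for E z
    by (simp add: trace_bits_def rev_map rev_filter)
  ultimately show ?thesis by simp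
qed

definition occurrences :: "'a list \<Rightarrow> ('a \<times> nat) set" where
  "occurrences u = {(s, j). j < count_list u s}"

lemma trace_bits_expand_Cons:
  "trace_bits E s (expand e (t # u)) =
     (if (s, t) \<in> E then [] else replicate (e (t, count_list u t)) (t = s)) @ trace_bits E s (expand e u)"
  by (simp add: trace_bits_def filter_replicate)

text \<open>
If \<open>s\<close> occurs in \<open>u\<close> but is not a descent, then some letter after its last occurrence does not commute
with \<open>s\<close>. So different occurrences of \<open>s\<close> in a reduced word give different blocks of ones.
\<close>

lemma hd_trace_bits_not_descent:
  assumes "s \<notin> descents E u" "sym E" and "\<And>i. i \<in> occurrences u \<Longrightarrow> e i > 0"
  shows "trace_bits E s (expand e u) = [] \<or> \<not> hd (trace_bits E s (expand e u))"
  using assms(1,3)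
proof (induction u)
  case Nil
  then show ?case by (simp add: trace_bits_def)
next
  case (Cons t u)
  have pos: "\<And>i. i \<in> occurrences u \<Longrightarrow> e i > 0"
    by (rule Cons.prems(2)) (auto simp: occurrences_def)
  have "e (t, count_list u t) > 0"
    by (rule Cons.prems(2)) (auto simp: occurrences_def)
  then show ?case
    using Cons.IH[OF _ pos] Cons.prems(1) by (auto simp: trace_bits_expand_Cons simp del: expand.simps)
qed

lemma replicate_append_inject:
  assumes "replicate k True @ bs = replicate l True @ cs"
    and "bs = [] \<or> \<not> hd bs" "cs = [] \<or> \<not> hd cs"
  shows "k = l \<and> bs = cs"
  using assms(1)
proof (induction k arbitrary: l)
  case 0
  then show ?case using assms(2) by (cases l) auto
next
  case (Suc k)
  show ?case
  proof (cases l)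
    case 0
    then show ?thesis using Suc.prems assms(3) by auto
  next
    case (Suc l')
    then show ?thesis using Suc.prems Suc.IH[of l'] by auto
  qed
qed

text \<open>
The blocks of ones have the exponents of \<open>s\<close> as their lengths. A block of zeros has as its length a
sum of exponents of several letters, and after removal of one of these letters the two sums may differ.
The induction therefore ignores the zeros in front of the first block of ones.
\<close>

lemma exponent_decode:
  assumes "reduced E u" "sym E" "irrefl E"
    and "\<And>i. i \<in> occurrences u \<Longrightarrow> e i > 0 \<and> e' i > 0"
    and "dropWhile Not (trace_bits E s (expand e u)) = dropWhile Not (trace_bits E s (expand e' u))"
    and "j < count_list u s"
  shows "e (s, j) = e' (s, j)"
  using assms(1,4,5,6)
proof (induction u)
  case (Cons t u)
  let ?B = "\<lambda>e. trace_bits E s (expand e u)"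
  have pos: "e i > 0" "e' i > 0" if "i \<in> occurrences u" for i
    using Cons.prems(2)[of i] that by (auto simp: occurrences_def split: if_splits)
  have pos_t: "e (t, count_list u t) > 0" "e' (t, count_list u t) > 0"
    using Cons.prems(2)[of "(t, count_list u t)"] by (auto simp: occurrences_def)
  have IH: "e (s, j) = e' (s, j)"
    if "dropWhile Not (?B e) = dropWhile Not (?B e')" "j < count_list u s"
    using Cons.IH[of] Cons.prems(1) pos that by simp
  have drop_F: "dropWhile Not (replicate k False @ bs) = dropWhile Not bs" for k bs
    by (induction k) auto
  show ?case
  proof (cases "t = s")
    case True
    have nE: "(s, s) \<notin> E" using assms(3) by (simp add: irrefl_def)
    let ?k = "e (s, count_list u s)" and ?l = "e' (s, count_list u s)"
    have drop_T: "dropWhile Not (replicate k True @ bs) = replicate k True @ bs" if "k > 0" for k bs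
      using that by (cases k) auto
    have "replicate ?k True @ ?B e = replicate ?l True @ ?B e'"
      using Cons.prems(3) pos_t True nE by (simp add: trace_bits_expand_Cons drop_T del: expand.simps)
    moreover have "s \<notin> descents E u" using Cons.prems(1) True by simp
    ultimately have "?k = ?l" "?B e = ?B e'"
      using replicate_append_inject hd_trace_bits_not_descent[OF _ assms(2)] pos by metis+
    then show ?thesis using IH Cons.prems(4) True by (cases "j = count_list u s") auto
  next
    case False
    then have "dropWhile Not (?B e) = dropWhile Not (?B e')"
      using Cons.prems(3) by (auto simp: trace_bits_expand_Cons drop_F simp del: expand.simps split: if_splits)
    then show ?thesis using IH Cons.prems(4) False by simp
  qed
qed simp

theorem expand_inject:
  assumes G: "pair_graph \<Gamma>" and u: "set u \<subseteq> pverts \<Gamma>" "reduced (parcs \<Gamma>) u"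
    and pos: "\<And>i. i \<in> occurrences u \<Longrightarrow> e i > 0 \<and> e' i > 0"
    and eq: "raag_monomial \<Gamma> (expand e u) = raag_monomial \<Gamma> (expand e' u)"
    and i: "i \<in> occurrences u"
  shows "e i = e' i"
proof -
  obtain s j where i': "i = (s, j)" "j < count_list u s" using i by (auto simp: occurrences_def)
  have "sym (parcs \<Gamma>)" "irrefl (parcs \<Gamma>)"
    using pair_graph_adj(2)[OF G] unfolding sym_def irrefl_def by blast+
  moreover have "trace_bits (parcs \<Gamma>) s (expand e u) = trace_bits (parcs \<Gamma>) s (expand e' u)"
    by (rule raag_monomial_trace_bits[OF G _ _ eq]) (use u set_expand[of _ u] in auto)
  ultimately show ?thesis
    using exponent_decode[where e = e and e' = e' and s = s and j = j, OF u(2) _ _ pos] i' by simp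
qed

lemma occurrences_Cons: "occurrences (s # u) = insert (s, count_list u s) (occurrences u)"
  by (auto simp: occurrences_def split: if_splits)

lemma card_occurrences: "finite (occurrences u) \<and> card (occurrences u) = length u"
proof (induction u)
  case (Cons s u)
  then show ?case by (simp add: occurrences_Cons) (simp add: occurrences_def)
qed (simp add: occurrences_def)

lemma length_expand_le:
  assumes "\<And>i. i \<in> occurrences u \<Longrightarrow> e i \<le> N"
  shows "length (expand e u) \<le> N * length u"
  using assms
proof (induction u)
  case (Cons s u)
  from Cons.prems[of "(s, count_list u s)"] Cons.IH Cons.prems show ?case
    by (simp add: occurrences_Cons add_mono)
qed simp

lemma occurrences_subset:
  assumes "u \<in> reduced_words \<Gamma> n m"
  shows "occurrences u \<subseteq> pverts \<Gamma> \<times> {..<m}"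
proof
  fix i assume "i \<in> occurrences u"
  then obtain s j where i: "i = (s, j)" "j < count_list u s" by (auto simp: occurrences_def)
  then have "s \<in> set u" using count_list_0_iff[of u s] by auto
  moreover have "j < m" using i(2) count_le_length[of u s] assms by (simp add: reduced_words_def)
  ultimately show "i \<in> pverts \<Gamma> \<times> {..<m}" using assms i(1) by (auto simp: reduced_words_def)
qed

text \<open>
In terms of probability: a given element is equal to \<open>\<phi>\<^sub>e(u)\<close> with probability at most
\<open>N\<^sup>-\<^sup>r\<close>, where \<open>r\<close> is the length of \<open>u\<close>, because it fixes the exponents of \<open>r\<close> different labels.
\<close>

lemma card_expand_fibre:
  fixes x :: "'a word set"
  assumes G: "pair_graph \<Gamma>" and u: "u \<in> reduced_words \<Gamma> 0 m"
  defines "I \<equiv> pverts \<Gamma> \<times> {..<m}"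
  shows "card {e \<in> I \<rightarrow>\<^sub>E {1..N}. raag_monomial \<Gamma> (expand e u) = x} * N ^ length u \<le> N ^ card I"
proof -
  let ?J = "occurrences u" and ?F = "{e \<in> I \<rightarrow>\<^sub>E {1..N}. raag_monomial \<Gamma> (expand e u) = x}"
  have u': "set u \<subseteq> pverts \<Gamma>" "reduced (parcs \<Gamma>) u"
    using u by (auto simp: reduced_words_def)
  have finI: "finite I" using pair_graph_adj(1)[OF G] by (simp add: I_def)
  have JI: "?J \<subseteq> I" using occurrences_subset[OF u] by (simp add: I_def)
  have "inj_on (\<lambda>e. restrict e (I - ?J)) ?F"
  proof (rule inj_onI)
    fix e e' assume e: "e \<in> ?F" "e' \<in> ?F" and r: "restrict e (I - ?J) = restrict e' (I - ?J)"
    show "e = e'"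
    proof
      fix i
      consider "i \<in> ?J" | "i \<in> I - ?J" | "i \<notin> I" by blast
      then show "e i = e' i"
      proof cases
        case 1
        have "e k > 0 \<and> e' k > 0" if "k \<in> ?J" for k
          using e that JI by (force simp: PiE_iff)
        then show ?thesis using expand_inject[OF G u'(1,2) _ _ 1, of e e'] e by simp
      next
        case 2
        then show ?thesis using fun_cong[OF r, of i] by simp
      next
        case 3
        then show ?thesis using e PiE_arb[of e I "\<lambda>_. {1..N}" i] PiE_arb[of e' I "\<lambda>_. {1..N}" i] by simp
      qed
    qed
  qed
  moreover have "(\<lambda>e. restrict e (I - ?J)) ` ?F \<subseteq> (I - ?J) \<rightarrow>\<^sub>E {1..N}"
    unfolding image_subset_iff restrict_PiE_iff by (auto simp: PiE_iff)
  ultimately have "card ?F \<le> card ((I - ?J) \<rightarrow>\<^sub>E {1..N})"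
    using finI by (intro card_inj_on_le) (auto intro!: finite_PiE)
  also have "\<dots> = N ^ (card I - length u)"
    using finI JI card_occurrences[of u] by (simp add: card_PiE card_Diff_subset)
  finally have "card ?F * N ^ length u \<le> N ^ (card I - length u) * N ^ length u"
    by (rule mult_right_mono) simp
  also have "\<dots> = N ^ card I"
    using card_mono[OF finI JI] card_occurrences[of u] by (simp flip: power_add)
  finally show ?thesis .
qed

section \<open>Word metrics and growth\<close>

lemma (in group) word_length_mult_le:
  assumes "S \<subseteq> carrier G" "generate G S = carrier G" "g \<in> carrier G" "h \<in> carrier G"
  shows "word_length G S (g \<otimes> h) \<le> word_length G S g + word_length G S h"
proof -
  have sub: "S \<union> m_inv G ` S \<subseteq> carrier G" using assms(1) by auto
  obtain xs where xs: "set xs \<subseteq> S \<union> m_inv G ` S" "foldr (monoid.mult G) xs \<one> = g"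
    "length xs = word_length G S g" using word_length_attained[OF assms(1-3)] .
  obtain ys where ys: "set ys \<subseteq> S \<union> m_inv G ` S" "foldr (monoid.mult G) ys \<one> = h"
    "length ys = word_length G S h" using word_length_attained[OF assms(1,2,4)] .
  have "foldr (monoid.mult G) (xs @ ys) \<one> = g \<otimes> h"
    using foldr_mult_append[OF order_trans[OF xs(1) sub] order_trans[OF ys(1) sub]] xs(2) ys(2)
    by (simp del: foldr_append)
  then have "word_length G S (g \<otimes> h) \<le> length (xs @ ys)"
    using xs(1) ys(1) by (intro word_length_le) auto
  then show ?thesis using xs(3) ys(3) by simp
qed

lemma (in group) word_dist_mult_right:
  assumes "g \<in> carrier G" "h \<in> carrier G"
  shows "word_dist G S g (g \<otimes> h) = real (word_length G S h)"
  using assms by (simp add: word_dist_def flip: m_assoc)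

lemma (in group) word_dist_mult_left:
  assumes "x \<in> carrier G" "g \<in> carrier G" "h \<in> carrier G"
  shows "word_dist G S (x \<otimes> g) (x \<otimes> h) = word_dist G S g h"
proof -
  have "inv x \<otimes> (x \<otimes> h) = h" using assms by (simp flip: m_assoc)
  then have "inv (x \<otimes> g) \<otimes> (x \<otimes> h) = inv g \<otimes> h"
    using assms by (simp add: inv_mult_group m_assoc)
  with assms show ?thesis by (simp add: word_dist_def)
qed

text \<open>
Its reflexive transitive closure is \<open>k\<close>-connectedness within \<open>Y\<close>.
\<close>

definition step_relation :: "('a \<Rightarrow> 'a \<Rightarrow> real) \<Rightarrow> real \<Rightarrow> 'a set \<Rightarrow> 'a rel" where
  "step_relation d k Y = {(a, b). a \<in> Y \<and> b \<in> Y \<and> d a b \<le> k}"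

text \<open>
A geodesic from \<open>x\<close> to \<open>y\<close> does not leave the ball around \<open>x\<close> that contains \<open>y\<close>.
\<close>

lemma (in group) ball_step_connected:
  assumes S: "S \<subseteq> carrier G" "generate G S = carrier G" and k: "1 \<le> k"
    and xy: "x \<in> carrier G" "y \<in> carrier G"
    and Y: "\<And>z. z \<in> carrier G \<Longrightarrow> word_dist G S x z \<le> word_dist G S x y \<Longrightarrow> z \<in> Y"
  shows "(x, y) \<in> (step_relation (word_dist G S) k Y)\<^sup>*"
proof -
  let ?p = "\<lambda>as. x \<otimes> foldr (monoid.mult G) as \<one>"
  have sub: "S \<union> m_inv G ` S \<subseteq> carrier G" using S(1) by auto
  have walk: "(x, ?p as) \<in> (step_relation (word_dist G S) k Y)\<^sup>*"
    if "set as \<subseteq> S \<union> m_inv G ` S" "real (length as) \<le> word_dist G S x y" for as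
    using that
  proof (induction as rule: rev_induct)
    case Nil
    then show ?case using xy by simp
  next
    case (snoc a as)
    have cl: "foldr (monoid.mult G) as \<one> \<in> carrier G" "a \<in> carrier G"
      using snoc.prems sub by (auto intro!: foldr_mult_closed)
    have inY: "?p bs \<in> Y" if "set bs \<subseteq> S \<union> m_inv G ` S" "real (length bs) \<le> word_dist G S x y" for bs
    proof (rule Y)
      have c: "foldr (monoid.mult G) bs \<one> \<in> carrier G" using that sub by (auto intro!: foldr_mult_closed)
      then show "?p bs \<in> carrier G" using xy by simp
      show "word_dist G S x (?p bs) \<le> word_dist G S x y"
        using word_dist_mult_right[OF xy(1) c, of S] word_length_le[OF that(1) HOL.refl] that(2) by simp
    qed
    have "set as \<subseteq> carrier G" using snoc.prems sub by auto
    then have eq: "?p (as @ [a]) = ?p as \<otimes> a"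
      using foldr_mult_append[of as "[a]"] cl xy by (simp add: m_assoc del: foldr_append)
    have "word_length G S a \<le> 1" using word_length_le[of "[a]" S a] snoc.prems cl by simp
    then have "word_dist G S (?p as) (?p (as @ [a])) \<le> k"
      unfolding eq using word_dist_mult_right[of "?p as" a S] cl xy k by simp
    moreover have "?p as \<in> Y" "?p (as @ [a]) \<in> Y"
      using inY[of as] inY[of "as @ [a]"] snoc.prems by (auto simp del: foldr_append)
    ultimately have "(?p as, ?p (as @ [a])) \<in> step_relation (word_dist G S) k Y"
      by (simp add: step_relation_def)
    then show ?case using snoc by (auto intro: rtrancl_into_rtrancl)
  qed
  have g: "inv x \<otimes> y \<in> carrier G" using xy by simp
  obtain as where as: "set as \<subseteq> S \<union> m_inv G ` S" "foldr (monoid.mult G) as \<one> = inv x \<otimes> y"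
    "length as = word_length G S (inv x \<otimes> y)" using word_length_attained[OF S g] .
  have "?p as = y" using as(2) xy by (simp flip: m_assoc)
  moreover have "real (length as) \<le> word_dist G S x y" using as(3) xy by (simp add: word_dist_def)
  ultimately show ?thesis using walk[OF as(1)] by simp
qed

definition word_ball :: "('a, 'b) monoid_scheme \<Rightarrow> 'a set \<Rightarrow> 'a \<Rightarrow> real \<Rightarrow> 'a set" where
  "word_ball G S x R = {g \<in> carrier G. word_dist G S x g \<le> R}"

lemma (in group) word_ball_translate:
  assumes "x \<in> carrier G"
  shows "word_ball G S x R = (\<lambda>g. x \<otimes> g) ` word_ball G S \<one> R"
proof
  show "(\<lambda>g. x \<otimes> g) ` word_ball G S \<one> R \<subseteq> word_ball G S x R"
    using assms word_dist_mult_left[OF assms one_closed, of _ S] by (auto simp: word_ball_def)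
  show "word_ball G S x R \<subseteq> (\<lambda>g. x \<otimes> g) ` word_ball G S \<one> R"
  proof
    fix g assume g: "g \<in> word_ball G S x R"
    then have *: "inv x \<otimes> g \<in> carrier G" "x \<otimes> (inv x \<otimes> g) = g"
      using assms by (auto simp: word_ball_def simp flip: m_assoc)
    then have "inv x \<otimes> g \<in> word_ball G S \<one> R"
      using g word_dist_mult_left[OF assms one_closed *(1), of S] assms by (simp add: word_ball_def)
    then show "g \<in> (\<lambda>g. x \<otimes> g) ` word_ball G S \<one> R" using *(2) by force
  qed
qed

lemma (in group) finite_word_ball:
  assumes "finite S" "S \<subseteq> carrier G" "generate G S = carrier G" and x: "x \<in> carrier G"
  shows "finite (word_ball G S x R) \<and> card (word_ball G S x R) = card (word_ball G S \<one> R)"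
proof -
  have fin: "finite {as. set as \<subseteq> S \<union> m_inv G ` S \<and> length as \<le> nat \<lceil>R\<rceil>}"
    using assms(1) by (intro finite_lists_length_le) simp
  have "word_ball G S \<one> R
      \<subseteq> (\<lambda>as. foldr (monoid.mult G) as \<one>) ` {as. set as \<subseteq> S \<union> m_inv G ` S \<and> length as \<le> nat \<lceil>R\<rceil>}"
  proof
    fix g assume g: "g \<in> word_ball G S \<one> R"
    then have c: "g \<in> carrier G" by (simp add: word_ball_def)
    obtain as where as: "set as \<subseteq> S \<union> m_inv G ` S" "foldr (monoid.mult G) as \<one> = g"
      "length as = word_length G S g" using word_length_attained[OF assms(2,3) c] .
    have "real (length as) \<le> R" using g c as(3) by (simp add: word_ball_def word_dist_def)
    then have "length as \<le> nat \<lceil>R\<rceil>" by linarith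
    then show "g \<in> (\<lambda>as. foldr (monoid.mult G) as \<one>) `
        {as. set as \<subseteq> S \<union> m_inv G ` S \<and> length as \<le> nat \<lceil>R\<rceil>}" using as(1,2) by blast
  qed
  then have "finite (word_ball G S \<one> R)" using finite_surj[OF fin] by blast
  moreover have "inj_on (\<lambda>g. x \<otimes> g) (word_ball G S \<one> R)"
    using x by (auto simp: inj_on_def word_ball_def)
  ultimately show ?thesis using word_ball_translate[OF x] by (simp add: card_image)
qed

lemma (in group) card_le_growth_fun:
  assumes S: "finite S" "S \<subseteq> carrier G" "generate G S = carrier G"
    and Z: "\<forall>Z\<in>\<Z>. Z \<subseteq> carrier G" "Z \<in> \<Z>" "z \<in> Z"
  shows "card (word_ball G S z R \<inter> Z) \<le> growth_fun (carrier G) (word_dist G S) \<Z> R"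
proof -
  interpret M: Metric_space "carrier G" "word_dist G S" by (rule Metric_space_word_dist[OF S(2,3)])
  have ball: "M.mcball s R = word_ball G S s R" if "s \<in> carrier G" for s
    using that by (auto simp: M.mcball_def word_ball_def)
  let ?A = "{card (M.mcball s R \<inter> Z) | s Z. Z \<in> \<Z> \<and> s \<in> Z}"
  have "bdd_above ?A"
  proof (rule bdd_aboveI[of _ "card (word_ball G S \<one> R)"])
    fix a assume "a \<in> ?A"
    then obtain s T where a: "a = card (M.mcball s R \<inter> T)" "T \<in> \<Z>" "s \<in> T" by blast
    then have s: "s \<in> carrier G" using Z(1) by blast
    have "card (M.mcball s R \<inter> T) \<le> card (word_ball G S s R)"
      unfolding ball[OF s] using finite_word_ball[OF S s, of R] by (intro card_mono) auto
    then show "a \<le> card (word_ball G S \<one> R)" using finite_word_ball[OF S s, of R] a(1) by simp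
  qed
  moreover have "z \<in> carrier G" using Z by blast
  then have "card (word_ball G S z R \<inter> Z) = card (M.mcball z R \<inter> Z)" by (simp add: ball)
  then have "card (word_ball G S z R \<inter> Z) \<in> ?A" using Z(2,3) by blast
  ultimately show ?thesis unfolding growth_fun_def by (intro cSup_upper)
qed

lemma subexponential_growth_bound:
  assumes "subexponential_growth X d \<S>" "0 < \<epsilon>"
  obtains R0 where "0 < R0" "\<And>r. R0 \<le> r \<Longrightarrow> real (growth_fun X d \<S> r) \<le> exp (\<epsilon> * r)"
proof -
  have "Limsup at_top (\<lambda>r::real. ereal (1 / r * ln (real (growth_fun X d \<S> r)))) < ereal \<epsilon>"
    using assms by (auto simp: subexponential_growth_def exponential_growth_def not_less
        intro: le_less_trans)
  then have "eventually (\<lambda>r::real. ereal (1 / r * ln (real (growth_fun X d \<S> r))) < ereal \<epsilon>) at_top"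
    by (rule Limsup_lessD)
  then obtain N where N: "\<And>r. N \<le> r \<Longrightarrow> 1 / r * ln (real (growth_fun X d \<S> r)) < \<epsilon>"
    by (auto simp: eventually_at_top_linorder)
  show thesis
  proof (rule that[of "max N 1"])
    fix r assume r: "max N 1 \<le> r"
    show "real (growth_fun X d \<S> r) \<le> exp (\<epsilon> * r)"
    proof (cases "growth_fun X d \<S> r = 0")
      case False
      have "ln (real (growth_fun X d \<S> r)) < \<epsilon> * r"
        using N[of r] r by (simp add: field_simps)
      then show ?thesis using False
        by (metis exp_le_cancel_iff exp_ln less_imp_le of_nat_0_less_iff gr0I)
    qed simp
  qed simp
qed

text \<open>
The balls that define the growth function are centred at points of \<open>Z\<close>, whereas \<open>p\<close> is arbitrary.
But if \<open>Z\<close> meets a ball around \<open>p\<close> at all, then this part of \<open>Z\<close> lies in a ball of twice the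
radius around one of its points.
\<close>

lemma (in group) card_neighbourhood_le:
  assumes S: "finite S" "S \<subseteq> carrier G" "generate G S = carrier G"
    and Z: "\<forall>Z\<in>\<Z>. Z \<subseteq> carrier G" "Z \<in> \<Z>" and p: "p \<in> carrier G"
  shows "card {g \<in> word_ball G S p \<rho>. \<exists>z\<in>Z. word_dist G S g z \<le> M}
      \<le> card (word_ball G S \<one> M) * growth_fun (carrier G) (word_dist G S) \<Z> (2 * (\<rho> + M))"
    (is "card ?A \<le> _")
proof -
  interpret M: Metric_space "carrier G" "word_dist G S" by (rule Metric_space_word_dist[OF S(2,3)])
  let ?T = "word_ball G S p (\<rho> + M) \<inter> Z"
  have Zc: "Z \<subseteq> carrier G" using Z by blast
  have finT: "finite ?T" using finite_word_ball[OF S p] by blast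
  have "?A \<subseteq> (\<Union>z\<in>?T. word_ball G S z M)"
  proof
    fix g assume "g \<in> ?A"
    then obtain z where z: "z \<in> Z" "word_dist G S g z \<le> M" and g: "g \<in> carrier G" "word_dist G S p g \<le> \<rho>"
      by (auto simp: word_ball_def)
    then have "z \<in> ?T" using M.triangle[of p g z] p Zc by (auto simp: word_ball_def)
    moreover have "g \<in> word_ball G S z M" using z g M.commute[of g z] by (auto simp: word_ball_def)
    ultimately show "g \<in> (\<Union>z\<in>?T. word_ball G S z M)" by blast
  qed
  then have "card ?A \<le> card (\<Union>z\<in>?T. word_ball G S z M)"
    using finT finite_word_ball[OF S] Zc by (intro card_mono) auto
  also have "\<dots> \<le> (\<Sum>z\<in>?T. card (word_ball G S z M))" by (rule card_UN_le[OF finT])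
  also have "\<dots> = card (word_ball G S \<one> M) * card ?T"
  proof -
    have "card (word_ball G S z M) = card (word_ball G S \<one> M)" if "z \<in> ?T" for z
      using finite_word_ball[OF S, of z] that Zc by auto
    then show ?thesis by simp
  qed
  also have "\<dots> \<le> card (word_ball G S \<one> M) * growth_fun (carrier G) (word_dist G S) \<Z> (2 * (\<rho> + M))"
  proof (rule mult_left_mono)
    show "card ?T \<le> growth_fun (carrier G) (word_dist G S) \<Z> (2 * (\<rho> + M))"
    proof (cases "?T = {}")
      case False
      then obtain z0 where z0: "z0 \<in> ?T" by blast
      have z0c: "z0 \<in> carrier G" using z0 Zc by blast
      have "?T \<subseteq> word_ball G S z0 (2 * (\<rho> + M)) \<inter> Z"
      proof
        fix z assume z: "z \<in> ?T"
        then have "word_dist G S z0 z \<le> word_dist G S p z0 + word_dist G S p z"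
          using M.triangle[of z0 p z] M.commute[of z0 p] z0c p Zc by auto
        then show "z \<in> word_ball G S z0 (2 * (\<rho> + M)) \<inter> Z" using z z0 by (auto simp: word_ball_def)
      qed
      then have "card ?T \<le> card (word_ball G S z0 (2 * (\<rho> + M)) \<inter> Z)"
        using finite_word_ball[OF S z0c] by (intro card_mono) auto
      also have "\<dots> \<le> growth_fun (carrier G) (word_dist G S) \<Z> (2 * (\<rho> + M))"
        using card_le_growth_fun[OF S Z] z0 by blast
      finally show ?thesis .
    qed simp
  qed simp
  finally show ?thesis .
qed

text \<open>
The infimum in the distance to \<open>Z\<close> need not be attained in a general metric space; enlarging \<open>L\<close> by \<open>1\<close> makes
up for this.
\<close>

lemma thickening_near:
  assumes "x \<in> thickening X d Z L"
  shows "\<exists>z\<in>Z. d x z \<le> L + 1"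
proof -
  have "(INF z\<in>Z. ereal (d x z)) < ereal (L + 1)"
    using assms by (auto simp: thickening_def set_dist_def intro: le_less_trans)
  then obtain z where "z \<in> Z" "ereal (d x z) < ereal (L + 1)" by (auto simp: INF_less_iff)
  then show ?thesis by (intro bexI[of _ z]) auto
qed

lemma set_dist_le: "z \<in> Z \<Longrightarrow> ereal D \<le> set_dist d x Z \<Longrightarrow> D \<le> d x z"
  by (metis INF_lower ereal_less_eq(3) order_trans set_dist_def)

section \<open>Components\<close>

lemma k_connected_step_relation:
  "k_connected d k A \<longleftrightarrow> (\<forall>x\<in>A. \<forall>y\<in>A. (x, y) \<in> (step_relation d k A)\<^sup>*)"
proof -
  have "(\<exists>xs. xs \<noteq> [] \<and> set xs \<subseteq> A \<and> hd xs = x \<and> last xs = y \<and> successively (\<lambda>u v. d u v \<le> k) xs)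
      \<longleftrightarrow> (x, y) \<in> (step_relation d k A)\<^sup>*" (is "?L \<longleftrightarrow> ?R") if x: "x \<in> A" for x y
  proof
    assume ?L
    then obtain xs where "xs \<noteq> []" "set xs \<subseteq> A" "hd xs = x" "last xs = y"
      "successively (\<lambda>u v. d u v \<le> k) xs" by blast
    then show ?R
    proof (induction xs arbitrary: x)
      case (Cons a xs)
      show ?case
      proof (cases xs)
        case Nil
        then show ?thesis using Cons.prems by simp
      next
        case C: (Cons b ys)
        then have "(b, y) \<in> (step_relation d k A)\<^sup>*"
          using Cons.prems by (intro Cons.IH) auto
        moreover have "(x, b) \<in> step_relation d k A"
          using Cons.prems C by (auto simp: step_relation_def)
        ultimately show ?thesis by (rule converse_rtrancl_into_rtrancl[rotated])
      qed
    qed simp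
  next
    assume ?R
    then show ?L
    proof induction
      case base
      show ?case by (rule exI[of _ "[x]"]) (use x in simp)
    next
      case (step y z)
      then obtain xs where xs: "xs \<noteq> []" "set xs \<subseteq> A" "hd xs = x" "last xs = y"
        "successively (\<lambda>u v. d u v \<le> k) xs" by blast
      moreover have "z \<in> A" "d y z \<le> k" using step.hyps(2) by (auto simp: step_relation_def)
      ultimately show ?case
        by (intro exI[of _ "xs @ [z]"]) (auto simp: successively_append_iff)
    qed
  qed
  then show ?thesis unfolding k_connected_def by blast
qed

lemma k_component_closed:
  assumes C: "k_component d k Y C" and sym: "\<And>a b. d a b = d b a"
    and x: "x \<in> C" and xy: "(x, y) \<in> (step_relation d k Y)\<^sup>*"
  shows "y \<in> C"
  using xy
proof induction
  case base
  show ?case by (rule x)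
next
  case (step a b)
  let ?R = "step_relation d k (insert b C)"
  have conn: "(u, v) \<in> ?R\<^sup>*" if "u \<in> C" "v \<in> C" for u v
  proof -
    have "(u, v) \<in> (step_relation d k C)\<^sup>*"
      using C that unfolding k_component_def k_connected_step_relation by blast
    moreover have "step_relation d k C \<subseteq> ?R" by (auto simp: step_relation_def)
    ultimately show ?thesis using rtrancl_mono[of "step_relation d k C" ?R] by blast
  qed
  have ab: "(a, b) \<in> ?R" "(b, a) \<in> ?R"
    using step sym[of a b] by (auto simp: step_relation_def)
  have "(u, v) \<in> ?R\<^sup>*" if uv: "u \<in> insert b C" "v \<in> insert b C" for u v
  proof -
    have "(u, a) \<in> ?R\<^sup>*" using uv(1) conn[OF _ step.IH] ab(2) by auto
    moreover have "(a, v) \<in> ?R\<^sup>*" using uv(2) conn[OF step.IH] ab(1) by auto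
    ultimately show ?thesis by (rule rtrancl_trans)
  qed
  then have "k_connected d k (insert b C)" by (simp add: k_connected_step_relation)
  moreover have "insert b C \<subseteq> Y" using C step.hyps(2) by (auto simp: k_component_def step_relation_def)
  ultimately have "insert b C = C" using C unfolding k_component_def by blast
  then show ?case by blast
qed

lemma k_component_unique:
  assumes C: "k_component d k Y C" "k_component d k Y C'" and sym: "\<And>a b. d a b = d b a"
    and xy: "x \<in> C" "y \<in> C'" "(x, y) \<in> (step_relation d k Y)\<^sup>*"
  shows "C = C'"
proof -
  have sub: "A \<subseteq> B" if AB: "k_component d k Y A" "k_component d k Y B" and y: "y \<in> A" "y \<in> B" for A B
  proof
    fix u assume "u \<in> A"
    then have "(y, u) \<in> (step_relation d k A)\<^sup>*"
      using AB(1) y(1) unfolding k_component_def k_connected_step_relation by blast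
    moreover have "step_relation d k A \<subseteq> step_relation d k Y"
      using AB(1) by (auto simp: step_relation_def k_component_def)
    ultimately have "(y, u) \<in> (step_relation d k Y)\<^sup>*"
      using rtrancl_mono[of "step_relation d k A"] by blast
    then show "u \<in> B" using k_component_closed[OF AB(2) sym y(2)] by blast
  qed
  have "y \<in> C" using k_component_closed[OF C(1) sym xy(1,3)] .
  then show ?thesis using sub C xy(2) by blast
qed

section \<open>Random images avoid subexponential families\<close>

locale unpinched_raag =
  fixes \<Gamma> :: "'a pair_pre_digraph" and S :: "'a word set set"
  assumes pair_graph: "pair_graph \<Gamma>" and unpinched: "unpinched \<Gamma>"
    and finite_generating_set: "finite_generating_set (raag \<Gamma>) S"
begin

sublocale group "raag \<Gamma>" by (rule group_raag)

lemma finite_gens: "finite S" "S \<subseteq> carrier (raag \<Gamma>)" "generate (raag \<Gamma>) S = carrier (raag \<Gamma>)"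
  using finite_generating_set by (auto simp: finite_generating_set_def)

sublocale Metric_space "carrier (raag \<Gamma>)" "word_dist (raag \<Gamma>) S"
  by (rule Metric_space_word_dist[OF finite_gens(2,3)])

abbreviation wdist :: "'a word set \<Rightarrow> 'a word set \<Rightarrow> real" where
  "wdist \<equiv> word_dist (raag \<Gamma>) S"

abbreviation image_point :: "('a \<times> nat \<Rightarrow> nat) \<Rightarrow> 'a list \<Rightarrow> 'a word set" where
  "image_point e u \<equiv> raag_monomial \<Gamma> (expand e u)"

definition gen_length :: nat where
  "gen_length = Max (insert 1 ((\<lambda>v. word_length (raag \<Gamma>) S (raag_gen \<Gamma> v)) ` pverts \<Gamma>))"

text \<open>
Of the factor \<open>8 card V\<close>, one \<open>card V\<close> pays for the choice of the next letter of a word and one factor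
\<open>2\<close> for the growth of \<open>Z\<close>; the remaining \<open>4\<close> makes the sum over all lengths converge.
\<close>

definition max_exponent :: nat where
  "max_exponent = 8 * card (pverts \<Gamma>)"

definition exponents :: "nat \<Rightarrow> ('a \<times> nat \<Rightarrow> nat) set" where
  "exponents m = pverts \<Gamma> \<times> {..<m} \<rightarrow>\<^sub>E {1..max_exponent}"

definition near :: "'a word set set \<Rightarrow> real \<Rightarrow> 'a word set \<Rightarrow> bool" where
  "near Z M g \<longleftrightarrow> (\<exists>z\<in>Z. wdist g z \<le> M)"

lemma finite_pverts: "finite (pverts \<Gamma>)"
  using pair_graph_adj(1)[OF pair_graph] .

lemma card_pverts_pos: "card (pverts \<Gamma>) > 0"
proof -
  have "is_clique \<Gamma> {}" by (simp add: is_clique_def)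
  then show ?thesis
    using unpinched_minus_clique_nonempty[OF unpinched] finite_pverts by (metis card_gt_0_iff empty_iff)
qed

lemma gen_length: "1 \<le> gen_length"
  "v \<in> pverts \<Gamma> \<Longrightarrow> word_length (raag \<Gamma>) S (raag_gen \<Gamma> v) \<le> gen_length"
  unfolding gen_length_def using finite_pverts by (auto intro!: Max_ge)

lemma monomial_length:
  "set x \<subseteq> pverts \<Gamma> \<Longrightarrow> word_length (raag \<Gamma>) S (raag_monomial \<Gamma> x) \<le> gen_length * length x"
proof (induction x)
  case Nil
  then show ?case using word_length_le[of "[]" S] by (simp add: raag_monomial_Nil)
next
  case (Cons s x)
  have s: "raag_monomial \<Gamma> [s] = raag_gen \<Gamma> s" by (simp add: raag_monomial_def raag_gen_def)
  have "raag_monomial \<Gamma> (s # x) = raag_monomial \<Gamma> x \<otimes>\<^bsub>raag \<Gamma>\<^esub> raag_monomial \<Gamma> [s]"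
    using raag_monomial_append[of x \<Gamma> "[s]"] Cons.prems by simp
  then have "word_length (raag \<Gamma>) S (raag_monomial \<Gamma> (s # x))
      \<le> word_length (raag \<Gamma>) S (raag_monomial \<Gamma> x) + word_length (raag \<Gamma>) S (raag_monomial \<Gamma> [s])"
    using word_length_mult_le[OF finite_gens(2,3)] raag_monomial_closed[of x \<Gamma>]
      raag_monomial_closed[of "[s]" \<Gamma>] Cons.prems by simp
  then show ?case using Cons gen_length(2)[of s] by (simp add: s)
qed

lemma image_point_closed: "u \<in> reduced_words \<Gamma> n m \<Longrightarrow> image_point e u \<in> carrier (raag \<Gamma>)"
  using set_expand[of e u] by (intro raag_monomial_closed) (auto simp: reduced_words_def)

lemma exponent_le:
  assumes "e \<in> exponents m" "u \<in> reduced_words \<Gamma> n m" "i \<in> occurrences u"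
  shows "e i \<le> max_exponent"
  using assms(1) subsetD[OF occurrences_subset[OF assms(2)] assms(3)]
  by (auto simp: exponents_def PiE_iff)

lemma dist_image_point:
  assumes "p \<in> carrier (raag \<Gamma>)" "e \<in> exponents m" "u \<in> reduced_words \<Gamma> n m"
  shows "wdist p (p \<otimes>\<^bsub>raag \<Gamma>\<^esub> image_point e u) \<le> gen_length * max_exponent * length u"
proof -
  have "set (expand e u) \<subseteq> pverts \<Gamma>"
    using set_expand[of e u] assms(3) by (auto simp: reduced_words_def)
  then have "word_length (raag \<Gamma>) S (image_point e u) \<le> gen_length * length (expand e u)"
    by (rule monomial_length)
  also have "\<dots> \<le> gen_length * (max_exponent * length u)"
    using exponent_le[OF assms(2,3)] by (intro mult_left_mono length_expand_le) auto
  finally show ?thesis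
    using word_dist_mult_right[OF assms(1) image_point_closed[OF assms(3)], of S]
    by (simp only: of_nat_le_iff mult.assoc of_nat_mult[symmetric])
qed

lemma finite_exponents: "finite (exponents m)"
  using finite_pverts by (auto simp: exponents_def intro!: finite_PiE)

lemma card_exponents: "card (exponents m) = max_exponent ^ card (pverts \<Gamma> \<times> {..<m})"
  using finite_pverts by (simp add: exponents_def card_PiE)

lemma card_exponents_pos: "card (exponents m) > 0"
  using card_pverts_pos by (simp add: card_exponents max_exponent_def)

definition bad_weight :: "real \<Rightarrow> real" where
  "bad_weight M = card (word_ball (raag \<Gamma>) S \<one>\<^bsub>raag \<Gamma>\<^esub> M)
    * exp (ln 2 / (gen_length * max_exponent) * M)"

text \<open>
The rate in the growth bound is chosen such that a radius of
\<open>gen_length * max_exponent * r\<close>, doubled in \<open>card_neighbourhood_le\<close>, yields a factor \<open>2\<^sup>r\<close>.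
\<close>

context
  fixes \<Z> :: "'a word set set set" and Z :: "'a word set set" and M R0 :: real
  assumes \<Z>: "\<forall>Z\<in>\<Z>. Z \<subseteq> carrier (raag \<Gamma>)" and Z: "Z \<in> \<Z>"
    and growth: "\<And>r. R0 \<le> r \<Longrightarrow> real (growth_fun (carrier (raag \<Gamma>)) wdist \<Z> r)
      \<le> exp (ln 2 / (2 * gen_length * max_exponent) * r)"
    and M: "0 \<le> M"
begin

text \<open>
A union bound over the elements near \<open>Z\<close> that the image of \<open>u\<close> can reach; each is
hit by a fraction of at most \<open>1 / max_exponent\<^sup>r\<close> of the choices of exponents, where \<open>r\<close> is the length of \<open>u\<close>.
\<close>

lemma card_near_one_word:
  assumes p: "p \<in> carrier (raag \<Gamma>)" and u: "u \<in> reduced_words \<Gamma> 0 m" and r: "R0 \<le> length u"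
  shows "card {e \<in> exponents m. near Z M (p \<otimes>\<^bsub>raag \<Gamma>\<^esub> image_point e u)}
    \<le> bad_weight M * (2 / max_exponent) ^ length u * card (exponents m)"
proof -
  let ?cN = "real gen_length * real max_exponent" and ?r = "length u"
  let ?A = "{g \<in> word_ball (raag \<Gamma>) S p (?cN * ?r). \<exists>z\<in>Z. wdist g z \<le> M}"
  let ?F = "\<lambda>g. {e \<in> exponents m. image_point e u = inv\<^bsub>raag \<Gamma>\<^esub> p \<otimes>\<^bsub>raag \<Gamma>\<^esub> g}"
  have N: "real max_exponent \<ge> 1" using card_pverts_pos by (simp add: max_exponent_def)
  have cN: "?cN \<ge> 1" using gen_length(1) N mult_mono[of 1 "real gen_length" 1 "real max_exponent"] by simp
  have finA: "finite ?A" using finite_word_ball[OF finite_gens p] by simp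
  have fibre: "real (card (?F g)) \<le> card (exponents m) / max_exponent ^ ?r" for g
  proof -
    have "card (?F g) * max_exponent ^ ?r \<le> card (exponents m)"
      unfolding card_exponents unfolding exponents_def by (rule card_expand_fibre[OF pair_graph u])
    from of_nat_mono[OF this, where 'a = real]
    have "real (card (?F g)) * real max_exponent ^ ?r \<le> real (card (exponents m))" by simp
    then show ?thesis using N by (simp add: field_simps)
  qed
  have "{e \<in> exponents m. near Z M (p \<otimes>\<^bsub>raag \<Gamma>\<^esub> image_point e u)} \<subseteq> (\<Union>g\<in>?A. ?F g)"
  proof
    fix e assume e: "e \<in> {e \<in> exponents m. near Z M (p \<otimes>\<^bsub>raag \<Gamma>\<^esub> image_point e u)}"
    let ?g = "p \<otimes>\<^bsub>raag \<Gamma>\<^esub> image_point e u"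
    have cl: "image_point e u \<in> carrier (raag \<Gamma>)" by (rule image_point_closed[OF u])
    have "wdist p ?g \<le> ?cN * ?r" using dist_image_point[OF p _ u, of e] e by simp
    then have "?g \<in> ?A" using e cl p by (auto simp: word_ball_def near_def)
    moreover have "e \<in> ?F ?g" using e cl p by (simp flip: m_assoc)
    ultimately show "e \<in> (\<Union>g\<in>?A. ?F g)" by blast
  qed
  then have "card {e \<in> exponents m. near Z M (p \<otimes>\<^bsub>raag \<Gamma>\<^esub> image_point e u)} \<le> card (\<Union>g\<in>?A. ?F g)"
    using finA finite_exponents by (intro card_mono) auto
  also have "\<dots> \<le> (\<Sum>g\<in>?A. card (?F g))" by (rule card_UN_le[OF finA])
  finally have "real (card {e \<in> exponents m. near Z M (p \<otimes>\<^bsub>raag \<Gamma>\<^esub> image_point e u)})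
      \<le> real (\<Sum>g\<in>?A. card (?F g))" by (rule of_nat_mono)
  also have "\<dots> = (\<Sum>g\<in>?A. real (card (?F g)))" by simp
  also have "\<dots> \<le> (\<Sum>g\<in>?A. card (exponents m) / max_exponent ^ ?r)"
    by (rule sum_mono) (rule fibre)
  also have "\<dots> = card ?A * (card (exponents m) / max_exponent ^ ?r)" by simp
  also have "\<dots> \<le> (bad_weight M * 2 ^ ?r) * (card (exponents m) / max_exponent ^ ?r)"
  proof (rule mult_right_mono)
    have "R0 \<le> 2 * (?cN * ?r + M)"
      using r M mult_mono[of 1 ?cN "real ?r" "real ?r"] cN by simp
    then have "real (growth_fun (carrier (raag \<Gamma>)) wdist \<Z> (2 * (?cN * ?r + M)))
        \<le> exp (ln 2 / (2 * gen_length * max_exponent) * (2 * (?cN * ?r + M)))"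
      by (rule growth)
    also have "\<dots> = exp (ln 2 / ?cN * M) * 2 ^ ?r"
    proof -
      have "ln 2 / (2 * gen_length * max_exponent) * (2 * (?cN * ?r + M)) = ln 2 / ?cN * M + ?r * ln 2"
        using cN N gen_length(1) by (simp add: field_simps)
      then show ?thesis by (simp add: exp_add exp_of_nat_mult)
    qed
    finally have g: "real (growth_fun (carrier (raag \<Gamma>)) wdist \<Z> (2 * (?cN * ?r + M)))
        \<le> exp (ln 2 / ?cN * M) * 2 ^ ?r" .
    have "real (card ?A) \<le> real (card (word_ball (raag \<Gamma>) S \<one>\<^bsub>raag \<Gamma>\<^esub> M))
        * real (growth_fun (carrier (raag \<Gamma>)) wdist \<Z> (2 * (?cN * ?r + M)))"
      using of_nat_mono[OF card_neighbourhood_le[OF finite_gens \<Z> Z p, of "?cN * ?r" M], where 'a = real]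
      by simp
    also have "\<dots> \<le> real (card (word_ball (raag \<Gamma>) S \<one>\<^bsub>raag \<Gamma>\<^esub> M)) * (exp (ln 2 / ?cN * M) * 2 ^ ?r)"
      by (rule mult_left_mono[OF g]) simp
    finally show "real (card ?A) \<le> bad_weight M * 2 ^ ?r" by (simp add: bad_weight_def mult.assoc)
  qed simp
  finally show ?thesis by (simp add: power_divide)
qed

text \<open>
A union bound over all words: for each length \<open>r \<ge> n\<close> the bad choices of exponents make up a fraction of at most
\<open>bad_weight M * 4\<^sup>-\<^sup>r\<close>.
\<close>

lemma card_near_some_word:
  assumes p: "p \<in> carrier (raag \<Gamma>)" and n: "R0 \<le> n"
  shows "card {e \<in> exponents m. \<exists>u\<in>reduced_words \<Gamma> n m. near Z M (p \<otimes>\<^bsub>raag \<Gamma>\<^esub> image_point e u)}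
    \<le> 2 * bad_weight M * (1/4) ^ n * card (exponents m)"
proof -
  let ?B = "\<lambda>u. {e \<in> exponents m. near Z M (p \<otimes>\<^bsub>raag \<Gamma>\<^esub> image_point e u)}"
  let ?W = "\<lambda>r. {u \<in> reduced_words \<Gamma> n m. length u = r}"
  have W: "finite (?W r)" "card (?W r) \<le> card (pverts \<Gamma>) ^ r" for r
  proof -
    have sub: "?W r \<subseteq> {u. set u \<subseteq> pverts \<Gamma> \<and> length u = r}" by (auto simp: reduced_words_def)
    have fin: "finite {u. set u \<subseteq> pverts \<Gamma> \<and> length u = r}"
      by (rule finite_lists_length_eq[OF finite_pverts])
    show "finite (?W r)" by (rule finite_subset[OF sub fin])
    show "card (?W r) \<le> card (pverts \<Gamma>) ^ r"
      using card_mono[OF fin sub] card_lists_length_eq[OF finite_pverts] by simp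
  qed
  have bw: "bad_weight M \<ge> 0" by (simp add: bad_weight_def)
  have "{e \<in> exponents m. \<exists>u\<in>reduced_words \<Gamma> n m. near Z M (p \<otimes>\<^bsub>raag \<Gamma>\<^esub> image_point e u)}
      \<subseteq> (\<Union>r\<in>{n..m}. \<Union>u\<in>?W r. ?B u)"
  proof clarify
    fix e u
    assume eu: "e \<in> exponents m" "u \<in> reduced_words \<Gamma> n m"
      "near Z M (p \<otimes>\<^bsub>raag \<Gamma>\<^esub> image_point e u)"
    then have "length u \<in> {n..m}" by (simp add: reduced_words_def)
    with eu show "e \<in> (\<Union>r\<in>{n..m}. \<Union>u\<in>?W r. ?B u)" by blast
  qed
  then have "card {e \<in> exponents m. \<exists>u\<in>reduced_words \<Gamma> n m. near Z M (p \<otimes>\<^bsub>raag \<Gamma>\<^esub> image_point e u)}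
      \<le> card (\<Union>r\<in>{n..m}. \<Union>u\<in>?W r. ?B u)"
    using W(1) finite_exponents by (intro card_mono) auto
  also have "\<dots> \<le> (\<Sum>r\<in>{n..m}. card (\<Union>u\<in>?W r. ?B u))" by (rule card_UN_le) simp
  also have "\<dots> \<le> (\<Sum>r\<in>{n..m}. \<Sum>u\<in>?W r. card (?B u))"
    by (intro sum_mono card_UN_le W(1))
  finally have "real (card {e \<in> exponents m. \<exists>u\<in>reduced_words \<Gamma> n m. near Z M (p \<otimes>\<^bsub>raag \<Gamma>\<^esub> image_point e u)})
      \<le> real (\<Sum>r\<in>{n..m}. \<Sum>u\<in>?W r. card (?B u))" by (rule of_nat_mono)
  also have "\<dots> = (\<Sum>r\<in>{n..m}. \<Sum>u\<in>?W r. real (card (?B u)))" by simp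
  also have "\<dots> \<le> (\<Sum>r\<in>{n..m}. bad_weight M * card (exponents m) * (1/4) ^ r)"
  proof (rule sum_mono)
    fix r assume r: "r \<in> {n..m}"
    have "(\<Sum>u\<in>?W r. real (card (?B u)))
        \<le> (\<Sum>u\<in>?W r. bad_weight M * (2 / max_exponent) ^ r * card (exponents m))"
    proof (rule sum_mono)
      fix u assume u: "u \<in> ?W r"
      then have "u \<in> reduced_words \<Gamma> 0 m" by (simp add: reduced_words_def)
      from card_near_one_word[OF p this] u n r
      show "real (card (?B u)) \<le> bad_weight M * (2 / max_exponent) ^ r * card (exponents m)" by auto
    qed
    also have "\<dots> = card (?W r) * (bad_weight M * (2 / max_exponent) ^ r * card (exponents m))" by simp
    also have "\<dots> \<le> card (pverts \<Gamma>) ^ r * (bad_weight M * (2 / max_exponent) ^ r * card (exponents m))"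
      using W(2)[of r] bw by (intro mult_right_mono) (auto simp flip: of_nat_power)
    also have "\<dots> = bad_weight M * card (exponents m) * (card (pverts \<Gamma>) * (2 / max_exponent)) ^ r"
      by (simp only: power_mult_distrib of_nat_power mult_ac)
    also have "card (pverts \<Gamma>) * (2 / max_exponent) = (1/4 :: real)"
      using card_pverts_pos by (simp add: max_exponent_def)
    finally show "(\<Sum>u\<in>?W r. real (card (?B u))) \<le> bad_weight M * card (exponents m) * (1/4) ^ r" .
  qed
  also have "\<dots> = bad_weight M * card (exponents m) * (\<Sum>r\<in>{n..m}. (1/4) ^ r)"
    by (simp add: sum_distrib_left)
  also have "\<dots> \<le> bad_weight M * card (exponents m) * (2 * (1/4) ^ n)"
  proof (rule mult_left_mono)
    have "(\<Sum>r\<in>{n..m}. (1/4::real) ^ r) \<le> 2 * (1/4) ^ n"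
      by (cases "n \<le> m") (auto simp: sum_gp intro: order_trans[of _ 0])
    then show "(\<Sum>r\<in>{n..m}. (1/4::real) ^ r) \<le> 2 * (1/4) ^ n" .
  qed (use bw in simp)
  finally show ?thesis by (simp add: mult_ac)
qed

text \<open>
One choice of exponents serves all base points. Points of \<open>P\<close> may lie on \<open>Z\<close>, so that
only the images of long words avoid \<open>Z\<close>. Points of \<open>Q\<close> are so far from \<open>Z\<close> that words shorter than \<open>n0\<close>
cannot reach it, and the longer ones are covered by the union bound.
\<close>

lemma exists_escaping_exponents:
  assumes P: "finite P" "P \<subseteq> carrier (raag \<Gamma>)" and Q: "finite Q" "Q \<subseteq> carrier (raag \<Gamma>)"
    and n: "R0 \<le> n0" "n0 \<le> n"
    and small: "2 * bad_weight M * (card Q * (1/4) ^ n0 + card P * (1/4) ^ n) < 1"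
    and far: "\<And>q z. q \<in> Q \<Longrightarrow> z \<in> Z \<Longrightarrow> M + gen_length * max_exponent * n0 < wdist q z"
  obtains e where "e \<in> exponents m"
    and "\<And>p u. p \<in> P \<Longrightarrow> u \<in> reduced_words \<Gamma> n m \<Longrightarrow> \<not> near Z M (p \<otimes>\<^bsub>raag \<Gamma>\<^esub> image_point e u)"
    and "\<And>q u. q \<in> Q \<Longrightarrow> u \<in> reduced_words \<Gamma> 0 m \<Longrightarrow> \<not> near Z M (q \<otimes>\<^bsub>raag \<Gamma>\<^esub> image_point e u)"
proof -
  let ?B = "\<lambda>n p. {e \<in> exponents m. \<exists>u\<in>reduced_words \<Gamma> n m. near Z M (p \<otimes>\<^bsub>raag \<Gamma>\<^esub> image_point e u)}"
  let ?U = "(\<Union>q\<in>Q. ?B n0 q) \<union> (\<Union>p\<in>P. ?B n p)"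
  have "real (card ?U) \<le> real ((\<Sum>q\<in>Q. card (?B n0 q)) + (\<Sum>p\<in>P. card (?B n p)))"
    using card_Un_le[of "\<Union>q\<in>Q. ?B n0 q" "\<Union>p\<in>P. ?B n p"]
      card_UN_le[OF Q(1), of "?B n0"] card_UN_le[OF P(1), of "?B n"] by linarith
  also have "\<dots> = (\<Sum>q\<in>Q. real (card (?B n0 q))) + (\<Sum>p\<in>P. real (card (?B n p)))" by simp
  also have "\<dots> \<le> (\<Sum>q\<in>Q. 2 * bad_weight M * (1/4) ^ n0 * card (exponents m))
      + (\<Sum>p\<in>P. 2 * bad_weight M * (1/4) ^ n * card (exponents m))"
    using n P Q by (intro add_mono sum_mono card_near_some_word) auto
  also have "\<dots> = 2 * bad_weight M * (card Q * (1/4) ^ n0 + card P * (1/4) ^ n) * card (exponents m)"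
    by (simp add: algebra_simps)
  also have "\<dots> < 1 * real (card (exponents m))"
    using small card_exponents_pos[of m] by (intro mult_strict_right_mono) auto
  finally have "card ?U < card (exponents m)" by simp
  moreover have "finite ?U" using P Q finite_exponents by auto
  ultimately obtain e where e: "e \<in> exponents m" "e \<notin> ?U"
    using card_mono[of ?U "exponents m"] by (meson not_less subsetI)
  show thesis
  proof (rule that[OF e(1)])
    show "\<not> near Z M (p \<otimes>\<^bsub>raag \<Gamma>\<^esub> image_point e u)" if "p \<in> P" "u \<in> reduced_words \<Gamma> n m" for p u
      using e that by blast
    fix q u assume q: "q \<in> Q" and u: "u \<in> reduced_words \<Gamma> 0 m"
    show "\<not> near Z M (q \<otimes>\<^bsub>raag \<Gamma>\<^esub> image_point e u)"
    proof (cases "n0 \<le> length u")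
      case True
      then have "u \<in> reduced_words \<Gamma> n0 m" using u by (simp add: reduced_words_def)
      then show ?thesis using e q by blast
    next
      case False
      have qc: "q \<in> carrier (raag \<Gamma>)" using q Q by blast
      let ?g = "q \<otimes>\<^bsub>raag \<Gamma>\<^esub> image_point e u"
      have "wdist q ?g \<le> gen_length * max_exponent * length u"
        by (rule dist_image_point[OF qc e(1) u])
      also have "\<dots> \<le> gen_length * max_exponent * n0"
        using False by (simp only: of_nat_le_iff) (simp add: mult_le_mono2)
      finally have g: "wdist q ?g \<le> gen_length * max_exponent * n0" by simp
      have "M < wdist ?g z" if z: "z \<in> Z" for z
      proof -
        have "z \<in> carrier (raag \<Gamma>)" using z \<Z> Z by blast
        then have "wdist q z \<le> wdist q ?g + wdist ?g z"
          using triangle[of q ?g z] qc image_point_closed[OF u] by simp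
        then show ?thesis using far[OF q z] g by simp
      qed
      then show ?thesis unfolding near_def by (meson not_le)
    qed
  qed
qed

end

end

section \<open>Connecting points that are far from the separating set\<close>

text \<open>
The word alternates between \<open>a\<close> and \<open>b\<close>.
\<close>

lemma exists_reduced_word_on_nonadjacent:
  assumes "a \<noteq> b" "(a, b) \<notin> E" "(b, a) \<notin> E"
  shows "\<exists>u. set u \<subseteq> {a, b} \<and> reduced E u \<and> length u = n"
proof -
  have "\<exists>u. set u \<subseteq> {a, b} \<and> reduced E u \<and> length u = n \<and>
      (descents E u \<subseteq> {a} \<or> descents E u \<subseteq> {b})"
  proof (induction n)
    case 0
    show ?case by (rule exI[of _ "[]"]) simp
  next
    case (Suc n)
    then obtain u where u: "set u \<subseteq> {a, b}" "reduced E u" "length u = n"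
      and "descents E u \<subseteq> {a} \<or> descents E u \<subseteq> {b}" by blast
    from this(4) show ?case
    proof
      assume "descents E u \<subseteq> {a}"
      then show ?thesis using u assms by (intro exI[of _ "b # u"]) auto
    next
      assume "descents E u \<subseteq> {b}"
      then show ?thesis using u assms by (intro exI[of _ "a # u"]) auto
    qed
  qed
  then show ?thesis by blast
qed

context unpinched_raag
begin

lemma exists_reduced_word_in_link:
  assumes s: "s \<in> pverts \<Gamma>" and n: "n \<le> m"
  shows "\<exists>u\<in>reduced_words \<Gamma> n m. \<forall>a\<in>set u. (s, a) \<in> parcs \<Gamma>"
proof -
  obtain a b where ab: "(s, a) \<in> parcs \<Gamma>" "(s, b) \<in> parcs \<Gamma>" "a \<noteq> b" "(a, b) \<notin> parcs \<Gamma>"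
    using unpinched_link_not_clique[OF pair_graph unpinched s] .
  have V: "a \<in> pverts \<Gamma>" "b \<in> pverts \<Gamma>"
    using pair_graph_adj(2)[OF pair_graph ab(1)] pair_graph_adj(2)[OF pair_graph ab(2)] by auto
  have "(b, a) \<notin> parcs \<Gamma>" using ab(4) pair_graph_adj(2)[OF pair_graph, of b a] by blast
  then obtain u where "set u \<subseteq> {a, b}" "reduced (parcs \<Gamma>) u" "length u = n"
    using exists_reduced_word_on_nonadjacent[OF ab(3,4)] by blast
  moreover from this have "u \<in> reduced_words \<Gamma> n m" using V n by (auto simp: reduced_words_def)
  ultimately show ?thesis using ab(1,2) by blast
qed

definition far_part :: "'a word set set \<Rightarrow> real \<Rightarrow> 'a word set set" where
  "far_part Z L = carrier (raag \<Gamma>) - thickening (carrier (raag \<Gamma>)) wdist Z L"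

abbreviation linked :: "'a word set set \<Rightarrow> real \<Rightarrow> real \<Rightarrow> 'a word set rel" where
  "linked Z L k \<equiv> (step_relation wdist k (far_part Z L))\<^sup>*"

lemma linked_sym:
  assumes "(g, h) \<in> linked Z L k"
  shows "(h, g) \<in> linked Z L k"
proof -
  have "sym (step_relation wdist k (far_part Z L))"
    by (auto simp: sym_def step_relation_def commute)
  then show ?thesis using assms by (rule symD[OF sym_rtrancl])
qed

text \<open>
The number \<open>\<delta>\<close> bounds the length of a single syllable \<open>s\<^sup>i\<close> with \<open>i \<le> max_exponent\<close>. Staying at
distance more than \<open>L + 1 + \<delta>\<close> from \<open>Z\<close> at the images of words leaves room for geodesics between
consecutive ones.
\<close>

context
  fixes Z :: "'a word set set" and L k \<delta> :: real
  assumes Z: "Z \<subseteq> carrier (raag \<Gamma>)" and k: "1 \<le> k"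
    and \<delta>: "\<delta> = gen_length * max_exponent"
begin

lemma linked_nearby:
  assumes g: "g \<in> carrier (raag \<Gamma>)" "\<not> near Z (L + 1 + \<delta>) g"
    and h: "h \<in> carrier (raag \<Gamma>)" "wdist g h \<le> \<delta>"
  shows "(g, h) \<in> linked Z L k"
proof (rule ball_step_connected[OF finite_gens(2,3) k g(1) h(1)])
  fix a assume a: "a \<in> carrier (raag \<Gamma>)" "wdist g a \<le> wdist g h"
  have "a \<notin> thickening (carrier (raag \<Gamma>)) wdist Z L"
  proof
    assume "a \<in> thickening (carrier (raag \<Gamma>)) wdist Z L"
    from thickening_near[OF this] obtain z where z: "z \<in> Z" "wdist a z \<le> L + 1" by blast
    have "z \<in> carrier (raag \<Gamma>)" using z(1) Z by (rule subsetD[rotated])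
    then have "wdist g z \<le> wdist g a + wdist a z" by (rule triangle[OF g(1) a(1)])
    also have "\<dots> \<le> L + 1 + \<delta>" using z(2) a(2) h(2) by linarith
    finally have "near Z (L + 1 + \<delta>) g" unfolding near_def using z(1) by (rule bexI)
    with g(2) show False by contradiction
  qed
  then show "a \<in> far_part Z L" using a(1) by (simp add: far_part_def)
qed

lemma linked_words:
  assumes p: "p \<in> carrier (raag \<Gamma>)" and e: "e \<in> exponents m"
    and away: "\<And>u. u \<in> reduced_words \<Gamma> n m \<Longrightarrow>
      \<not> near Z (L + 1 + \<delta>) (p \<otimes>\<^bsub>raag \<Gamma>\<^esub> image_point e u)"
    and uv: "word_connected \<Gamma> n m u v"
  shows "(p \<otimes>\<^bsub>raag \<Gamma>\<^esub> image_point e u, p \<otimes>\<^bsub>raag \<Gamma>\<^esub> image_point e v) \<in> linked Z L k"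
  using uv
proof induction
  case (refl u)
  show ?case by simp
next
  case (sym u v)
  from sym.IH show ?case by (rule linked_sym)
next
  case (trans u v w)
  from trans.IH show ?case by (rule rtrancl_trans)
next
  case (push u s)
  let ?s = "replicate (e (s, count_list u s)) s"
  have V: "set ?s \<subseteq> pverts \<Gamma>" "set (expand e u) \<subseteq> pverts \<Gamma>"
    using push set_expand[of e u] by (auto simp: reduced_words_def)
  have cl: "image_point e u \<in> carrier (raag \<Gamma>)" "raag_monomial \<Gamma> ?s \<in> carrier (raag \<Gamma>)"
    using V by (auto intro: raag_monomial_closed)
  have eq: "p \<otimes>\<^bsub>raag \<Gamma>\<^esub> image_point e (s # u)
      = (p \<otimes>\<^bsub>raag \<Gamma>\<^esub> image_point e u) \<otimes>\<^bsub>raag \<Gamma>\<^esub> raag_monomial \<Gamma> ?s"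
    using raag_monomial_append[OF V(2,1)] cl p by (simp add: m_assoc)
  have "(s, count_list u s) \<in> occurrences (s # u)" by (simp add: occurrences_def)
  then have "length ?s \<le> max_exponent" using exponent_le[OF e push(2)] by simp
  then have "word_length (raag \<Gamma>) S (raag_monomial \<Gamma> ?s) \<le> gen_length * max_exponent"
    using monomial_length[OF V(1)] by (meson mult_le_mono2 order_trans)
  then have "real (word_length (raag \<Gamma>) S (raag_monomial \<Gamma> ?s)) \<le> \<delta>"
    unfolding \<delta> by (rule of_nat_mono)
  then have "wdist (p \<otimes>\<^bsub>raag \<Gamma>\<^esub> image_point e u) (p \<otimes>\<^bsub>raag \<Gamma>\<^esub> image_point e (s # u)) \<le> \<delta>"
    unfolding eq using word_dist_mult_right[of "p \<otimes>\<^bsub>raag \<Gamma>\<^esub> image_point e u"] cl p by simp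
  moreover have "p \<otimes>\<^bsub>raag \<Gamma>\<^esub> image_point e (s # u) \<in> carrier (raag \<Gamma>)"
    unfolding eq using cl p by simp
  moreover have "p \<otimes>\<^bsub>raag \<Gamma>\<^esub> image_point e u \<in> carrier (raag \<Gamma>)" using cl(1) p by simp
  ultimately show ?case using away[OF push(1)] by (intro linked_nearby)
next
  case (swap xs s t ys)
  have "set (xs @ s # t # ys) \<subseteq> pverts \<Gamma>" using swap(1) by (simp add: reduced_words_def)
  then show ?case using expand_swap[OF pair_graph swap(2)] by simp
qed

lemma letter_length:
  assumes "v \<in> pverts \<Gamma>"
  shows "word_length (raag \<Gamma>) S (raag_rel \<Gamma> `` {[(v, b)]}) \<le> gen_length"
proof (cases b)
  case True
  then show ?thesis using gen_length(2)[OF assms] by (simp add: raag_gen_def)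
next
  case False
  let ?g = "raag_gen \<Gamma> v"
  have g: "?g \<in> carrier (raag \<Gamma>)" by (rule raag_gen_closed[OF assms])
  have "real (word_length (raag \<Gamma>) S (inv\<^bsub>raag \<Gamma>\<^esub> ?g)) = wdist \<one>\<^bsub>raag \<Gamma>\<^esub> (inv\<^bsub>raag \<Gamma>\<^esub> ?g)"
    using word_dist_mult_right[OF one_closed, of "inv\<^bsub>raag \<Gamma>\<^esub> ?g" S] g by simp
  also have "\<dots> = wdist (inv\<^bsub>raag \<Gamma>\<^esub> ?g) \<one>\<^bsub>raag \<Gamma>\<^esub>" by (rule commute)
  also have "\<dots> = real (word_length (raag \<Gamma>) S ?g)"
    using word_dist_mult_right[of "inv\<^bsub>raag \<Gamma>\<^esub> ?g" ?g S] g by simp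
  finally show ?thesis using gen_length(2)[OF assms] False raag_gen_inv[OF assms] by simp
qed

lemma letter_commute:
  assumes v: "v \<in> pverts \<Gamma>" and x: "\<forall>t\<in>set x. (v, t) \<in> parcs \<Gamma>"
  shows "raag_rel \<Gamma> `` {[(v, b)]} \<otimes>\<^bsub>raag \<Gamma>\<^esub> raag_monomial \<Gamma> x
    = raag_monomial \<Gamma> x \<otimes>\<^bsub>raag \<Gamma>\<^esub> raag_rel \<Gamma> `` {[(v, b)]}"
proof -
  have xV: "set x \<subseteq> pverts \<Gamma>" using x pair_graph_adj(2)[OF pair_graph] by blast
  let ?g = "raag_gen \<Gamma> v" and ?h = "raag_monomial \<Gamma> x"
  have g: "?g = raag_monomial \<Gamma> [v]" by (simp add: raag_gen_def raag_monomial_def)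
  have cl: "?g \<in> carrier (raag \<Gamma>)" "?h \<in> carrier (raag \<Gamma>)"
    using raag_gen_closed[OF v] raag_monomial_closed[OF xV] .
  have comm: "?g \<otimes>\<^bsub>raag \<Gamma>\<^esub> ?h = ?h \<otimes>\<^bsub>raag \<Gamma>\<^esub> ?g"
    using raag_monomial_commute[OF pair_graph, of x "[v]"] raag_monomial_append[of x \<Gamma> "[v]"]
      raag_monomial_append[of "[v]" \<Gamma> x] x xV v by (simp add: g)
  show ?thesis
  proof (cases b)
    case True
    then show ?thesis using comm by (simp add: raag_gen_def)
  next
    case False
    have "inv\<^bsub>raag \<Gamma>\<^esub> ?g \<otimes>\<^bsub>raag \<Gamma>\<^esub> ?h
        = inv\<^bsub>raag \<Gamma>\<^esub> ?g \<otimes>\<^bsub>raag \<Gamma>\<^esub> (?h \<otimes>\<^bsub>raag \<Gamma>\<^esub> ?g) \<otimes>\<^bsub>raag \<Gamma>\<^esub> inv\<^bsub>raag \<Gamma>\<^esub> ?g"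
      using cl by (simp add: m_assoc)
    also have "\<dots> = ?h \<otimes>\<^bsub>raag \<Gamma>\<^esub> inv\<^bsub>raag \<Gamma>\<^esub> ?g"
      unfolding comm[symmetric] using cl by (simp flip: m_assoc)
    finally show ?thesis using False raag_gen_inv[OF v] by simp
  qed
qed

text \<open>
To pass from one point of the path to the next, which differs by a letter \<open>s\<close>, choose a
word \<open>t\<close> in the link of \<open>s\<close>: translating by \<open>\<phi>\<^sub>e(t)\<close> on the right keeps the two points adjacent, and the
translates are away from \<open>Z\<close> although the points of the path need not be.
\<close>

lemma linked_along_path:
  assumes p: "p \<in> carrier (raag \<Gamma>)" and w: "w \<in> raag_words \<Gamma>" and e: "e \<in> exponents (n + 1)"
    and away: "\<And>i u. i \<le> length w \<Longrightarrow> u \<in> reduced_words \<Gamma> n (n + 1) \<Longrightarrow>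
      \<not> near Z (L + 1 + \<delta>) (p \<otimes>\<^bsub>raag \<Gamma>\<^esub> raag_rel \<Gamma> `` {take i w} \<otimes>\<^bsub>raag \<Gamma>\<^esub> image_point e u)"
    and u: "u \<in> reduced_words \<Gamma> n (n + 1)" and i: "i \<le> length w" and v: "v \<in> reduced_words \<Gamma> n (n + 1)"
  shows "(p \<otimes>\<^bsub>raag \<Gamma>\<^esub> image_point e u,
      p \<otimes>\<^bsub>raag \<Gamma>\<^esub> raag_rel \<Gamma> `` {take i w} \<otimes>\<^bsub>raag \<Gamma>\<^esub> image_point e v) \<in> linked Z L k"
  using i v
proof (induction i arbitrary: v)
  case 0
  have "raag_rel \<Gamma> `` {take 0 w} = \<one>\<^bsub>raag \<Gamma>\<^esub>"
    using raag_monomial_Nil[of \<Gamma>] by (simp add: raag_monomial_def)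
  then have one: "p \<otimes>\<^bsub>raag \<Gamma>\<^esub> raag_rel \<Gamma> `` {take 0 w} = p" using p by simp
  have "word_connected \<Gamma> n (n + 1) u v"
    using word_connected_beyond[OF pair_graph unpinched _ u 0(2)] by simp
  from linked_words[OF p e _ this] away[of 0] show ?case unfolding one by simp
next
  case (Suc i)
  let ?q = "\<lambda>i. p \<otimes>\<^bsub>raag \<Gamma>\<^esub> raag_rel \<Gamma> `` {take i w}"
  obtain s b where sb: "w ! i = (s, b)" by (cases "w ! i")
  let ?l = "raag_rel \<Gamma> `` {[(s, b)]}"
  have take: "take (Suc i) w = take i w @ [(s, b)]" using Suc.prems sb by (simp add: take_Suc_conv_app_nth)
  have words: "take j w \<in> raag_words \<Gamma>" for j
    using w set_take_subset[of j w] unfolding raag_words_def by blast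
  have s: "s \<in> pverts \<Gamma>" using words[of "Suc i"] by (simp add: take)
  have lc: "?l \<in> carrier (raag \<Gamma>)" using s by (intro raag_carrierI) simp
  have qc: "?q j \<in> carrier (raag \<Gamma>)" for j using p raag_carrierI[OF words[of j]] by simp
  have q: "?q (Suc i) = ?q i \<otimes>\<^bsub>raag \<Gamma>\<^esub> ?l"
    using raag_mult[OF words[of i], of "[(s, b)]"] s p raag_carrierI[OF words[of i]] lc
    by (simp add: take m_assoc)
  obtain t where tr: "t \<in> reduced_words \<Gamma> n (n + 1)" and t: "\<forall>a\<in>set t. (s, a) \<in> parcs \<Gamma>"
    using exists_reduced_word_in_link[OF s, of n "n + 1"] by auto
  have tc: "image_point e t \<in> carrier (raag \<Gamma>)" by (rule image_point_closed[OF tr])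
  have "(p \<otimes>\<^bsub>raag \<Gamma>\<^esub> image_point e u, ?q i \<otimes>\<^bsub>raag \<Gamma>\<^esub> image_point e t) \<in> linked Z L k"
    using Suc.IH[OF _ tr] Suc.prems by simp
  also have "(?q i \<otimes>\<^bsub>raag \<Gamma>\<^esub> image_point e t, ?q (Suc i) \<otimes>\<^bsub>raag \<Gamma>\<^esub> image_point e t) \<in> linked Z L k"
  proof (rule linked_nearby)
    have comm: "?l \<otimes>\<^bsub>raag \<Gamma>\<^esub> image_point e t = image_point e t \<otimes>\<^bsub>raag \<Gamma>\<^esub> ?l"
      using set_expand[of e t] t by (intro letter_commute[OF s]) auto
    have eq: "?q (Suc i) \<otimes>\<^bsub>raag \<Gamma>\<^esub> image_point e t = (?q i \<otimes>\<^bsub>raag \<Gamma>\<^esub> image_point e t) \<otimes>\<^bsub>raag \<Gamma>\<^esub> ?l"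
      unfolding q by (simp only: m_assoc[OF qc lc tc] m_assoc[OF qc tc lc] comm)
    have "real gen_length * 1 \<le> \<delta>"
      unfolding \<delta> of_nat_mult using card_pverts_pos by (intro mult_left_mono) (auto simp: max_exponent_def)
    then have "real (word_length (raag \<Gamma>) S ?l) \<le> \<delta>" using letter_length[OF s, of b] by simp
    then show "wdist (?q i \<otimes>\<^bsub>raag \<Gamma>\<^esub> image_point e t) (?q (Suc i) \<otimes>\<^bsub>raag \<Gamma>\<^esub> image_point e t) \<le> \<delta>"
      unfolding eq using word_dist_mult_right[of "?q i \<otimes>\<^bsub>raag \<Gamma>\<^esub> image_point e t" ?l S] qc[of i] tc lc by simp
    show "\<not> near Z (L + 1 + \<delta>) (?q i \<otimes>\<^bsub>raag \<Gamma>\<^esub> image_point e t)"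
      using away[OF _ tr, of i] Suc.prems by simp
  qed (use qc tc in auto)
  also have "(?q (Suc i) \<otimes>\<^bsub>raag \<Gamma>\<^esub> image_point e t, ?q (Suc i) \<otimes>\<^bsub>raag \<Gamma>\<^esub> image_point e v) \<in> linked Z L k"
  proof (rule linked_words[OF qc e])
    show "word_connected \<Gamma> n (n + 1) t v"
      using word_connected_beyond[OF pair_graph unpinched _ tr Suc.prems(2)] by simp
  qed (use away[OF Suc.prems(1)] in blast)
  finally show ?case .
qed

end

lemma eventually_small: "\<exists>n\<ge>n0. C * (1/4::real) ^ n < 1/2"
proof -
  have "(\<lambda>n. C * (1/4::real) ^ n) \<longlonglongrightarrow> C * 0"
    by (intro tendsto_mult tendsto_const LIMSEQ_power_zero) simp
  then have "eventually (\<lambda>n. C * (1/4::real) ^ n < 1/2) sequentially"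
    by (rule order_tendstoD) simp
  then obtain N where "\<And>n. n \<ge> N \<Longrightarrow> C * (1/4::real) ^ n < 1/2"
    by (auto simp: eventually_sequentially)
  then show ?thesis by (intro exI[of _ "max N n0"]) auto
qed

text \<open>
The order of the choices matters: \<open>n0\<close> and hence \<open>D\<close> depend only on the growth of the family,
whereas \<open>n\<close> is chosen after \<open>Z\<close>, \<open>x\<close>, \<open>y\<close> and may depend on the length of a path from \<open>x\<close> to \<open>y\<close>.
\<close>

theorem far_points_linked:
  assumes \<Z>: "\<forall>Z\<in>\<Z>. Z \<subseteq> carrier (raag \<Gamma>)"
    and sub: "subexponential_growth (carrier (raag \<Gamma>)) wdist \<Z>"
    and L: "0 \<le> L" and k: "1 \<le> k"
  shows "\<exists>D\<ge>0. \<forall>Z\<in>\<Z>. \<forall>x\<in>carrier (raag \<Gamma>). \<forall>y\<in>carrier (raag \<Gamma>).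
    (\<forall>z\<in>Z. D \<le> wdist x z) \<longrightarrow> (\<forall>z\<in>Z. D \<le> wdist y z) \<longrightarrow> (x, y) \<in> linked Z L k"
proof -
  define \<delta> where "\<delta> = real (gen_length * max_exponent)"
  define M where "M = L + 1 + \<delta>"
  have \<delta>_pos: "\<delta> > 0" using gen_length(1) card_pverts_pos by (simp add: \<delta>_def max_exponent_def)
  have M: "0 \<le> M" using L \<delta>_pos by (simp add: M_def)
  have "0 < ln 2 / (real (2 * gen_length * max_exponent))"
    using \<delta>_pos by (intro divide_pos_pos) (simp_all add: \<delta>_def mult.assoc)
  from subexponential_growth_bound[OF sub this] obtain R0 where growth:
    "\<And>r. R0 \<le> r \<Longrightarrow> real (growth_fun (carrier (raag \<Gamma>)) wdist \<Z> r)
      \<le> exp (ln 2 / (real (2 * gen_length * max_exponent)) * r)" by blast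
  obtain n0 where n0: "n0 \<ge> nat \<lceil>R0\<rceil>" "(2 * bad_weight M * 2) * (1/4) ^ n0 < 1/2"
    using eventually_small by blast
  then have R0: "R0 \<le> real n0" by linarith
  let ?D = "M + \<delta> * n0 + 1"
  have "(x, y) \<in> linked Z L k"
    if Z: "Z \<in> \<Z>" and x: "x \<in> carrier (raag \<Gamma>)" and y: "y \<in> carrier (raag \<Gamma>)"
      and far: "\<forall>z\<in>Z. ?D \<le> wdist x z" "\<forall>z\<in>Z. ?D \<le> wdist y z" for Z x y
  proof -
    have Zc: "Z \<subseteq> carrier (raag \<Gamma>)" using Z \<Z> by blast
    obtain w where w: "w \<in> raag_words \<Gamma>" "inv\<^bsub>raag \<Gamma>\<^esub> x \<otimes>\<^bsub>raag \<Gamma>\<^esub> y = raag_rel \<Gamma> `` {w}"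
      using raag_carrierE[of "inv\<^bsub>raag \<Gamma>\<^esub> x \<otimes>\<^bsub>raag \<Gamma>\<^esub> y" \<Gamma>] x y by blast
    let ?q = "\<lambda>i. x \<otimes>\<^bsub>raag \<Gamma>\<^esub> raag_rel \<Gamma> `` {take i w}"
    have "x \<otimes>\<^bsub>raag \<Gamma>\<^esub> (inv\<^bsub>raag \<Gamma>\<^esub> x \<otimes>\<^bsub>raag \<Gamma>\<^esub> y) = y"
      using x y by (simp flip: m_assoc)
    then have yq: "?q (length w) = y" by (simp add: w(2))
    define P where "P = ?q ` {..length w}"
    have "take j w \<in> raag_words \<Gamma>" for j
      using w(1) set_take_subset[of j w] unfolding raag_words_def by blast
    then have P: "finite P" "P \<subseteq> carrier (raag \<Gamma>)" using x by (auto simp: P_def intro!: raag_carrierI)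
    obtain n where n: "n \<ge> n0" "(2 * bad_weight M * card P) * (1/4) ^ n < 1/2"
      using eventually_small by blast
    have "card {x, y} \<le> 2" by (simp add: card_insert_if)
    then have "2 * bad_weight M * (card {x, y} * (1/4) ^ n0) \<le> 2 * bad_weight M * (2 * (1/4) ^ n0)"
      by (intro mult_left_mono mult_right_mono) (auto simp: bad_weight_def)
    then have small: "2 * bad_weight M * (card {x, y} * (1/4) ^ n0 + card P * (1/4) ^ n) < 1"
      using n0(2) n(2) by (simp add: algebra_simps)
    have "M + gen_length * max_exponent * n0 < wdist q z" if "q \<in> {x, y}" "z \<in> Z" for q z
    proof -
      have "?D \<le> wdist q z" using far that by blast
      then show ?thesis by (simp add: \<delta>_def)
    qed
    from exists_escaping_exponents[OF \<Z> Z growth M P _ _ R0 n(1) small this, of "n + 1"] x y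
    obtain e where e: "e \<in> exponents (n + 1)"
      and away: "\<And>p u. p \<in> P \<Longrightarrow> u \<in> reduced_words \<Gamma> n (n + 1) \<Longrightarrow>
          \<not> near Z M (p \<otimes>\<^bsub>raag \<Gamma>\<^esub> image_point e u)"
      and away': "\<And>q u. q \<in> {x, y} \<Longrightarrow> u \<in> reduced_words \<Gamma> 0 (n + 1) \<Longrightarrow>
          \<not> near Z M (q \<otimes>\<^bsub>raag \<Gamma>\<^esub> image_point e u)" by auto
    obtain s where s: "s \<in> pverts \<Gamma>" using card_pverts_pos by fastforce
    obtain u where u: "u \<in> reduced_words \<Gamma> n (n + 1)"
      using exists_reduced_word_in_link[OF s, of n "n + 1"] by auto
    have u0: "u \<in> reduced_words \<Gamma> 0 (n + 1)" "[] \<in> reduced_words \<Gamma> 0 (n + 1)"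
      using u by (auto simp: reduced_words_def)
    have conn: "word_connected \<Gamma> 0 (n + 1) [] u"
      by (rule word_connected_beyond[OF pair_graph unpinched _ u0(2,1)]) simp
    have exit: "(q, q \<otimes>\<^bsub>raag \<Gamma>\<^esub> image_point e u) \<in> linked Z L k" if "q \<in> {x, y}" for q
    proof -
      have q: "q \<in> carrier (raag \<Gamma>)" using that x y by blast
      show ?thesis
        using linked_words[OF Zc k \<delta>_def q e _ conn] away'[OF that] q
        by (simp add: M_def raag_monomial_Nil)
    qed
    have "(x, x \<otimes>\<^bsub>raag \<Gamma>\<^esub> image_point e u) \<in> linked Z L k" by (rule exit) simp
    also have "(x \<otimes>\<^bsub>raag \<Gamma>\<^esub> image_point e u, ?q (length w) \<otimes>\<^bsub>raag \<Gamma>\<^esub> image_point e u) \<in> linked Z L k"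
    proof (rule linked_along_path[OF Zc k \<delta>_def x w(1) e _ u _ u])
      fix i v assume "i \<le> length w" "v \<in> reduced_words \<Gamma> n (n + 1)"
      then show "\<not> near Z (L + 1 + \<delta>) (?q i \<otimes>\<^bsub>raag \<Gamma>\<^esub> image_point e v)"
        using away[of "?q i" v] by (simp add: P_def M_def)
    qed simp
    also have "(?q (length w) \<otimes>\<^bsub>raag \<Gamma>\<^esub> image_point e u, y) \<in> linked Z L k"
      unfolding yq by (rule linked_sym[OF exit]) simp
    finally show ?thesis .
  qed
  moreover have "0 \<le> ?D" using M \<delta>_pos by simp
  ultimately show ?thesis by (intro exI[of _ ?D]) blast
qed

theorem no_subexp_separating_family:
  "\<not> admits_subexp_separating_family (raag \<Gamma>) S"
proof
  assume "admits_subexp_separating_family (raag \<Gamma>) S"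
  then obtain \<Z> where \<Z>: "\<forall>Z\<in>\<Z>. Z \<subseteq> carrier (raag \<Gamma>)"
    and sep: "coarsely_separated_by (carrier (raag \<Gamma>)) wdist \<Z>"
    and sub: "subexponential_growth (carrier (raag \<Gamma>)) wdist \<Z>"
    by (auto simp: admits_subexp_separating_family_def)
  from sep obtain k L where L: "0 \<le> L" and kX: "k_connected wdist k (carrier (raag \<Gamma>))"
    and sepD: "\<And>D. D \<ge> 0 \<Longrightarrow> \<exists>Z\<in>\<Z>. \<exists>C\<^sub>1 C\<^sub>2.
      k_component wdist k (far_part Z L) C\<^sub>1 \<and> k_component wdist k (far_part Z L) C\<^sub>2 \<and> C\<^sub>1 \<noteq> C\<^sub>2 \<and>
      (\<exists>x\<in>C\<^sub>1. set_dist wdist x Z \<ge> ereal D) \<and> (\<exists>x\<in>C\<^sub>2. set_dist wdist x Z \<ge> ereal D)"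
    unfolding coarsely_separated_by_def far_part_def by blast
  \<comment> \<open>Distances are integers, so for \<open>k < 1\<close> only a one-point space is \<open>k\<close>-connected, and it cannot
    have two different components.\<close>
  have k: "1 \<le> k"
  proof (rule ccontr)
    assume "\<not> 1 \<le> k"
    have "step_relation wdist k (carrier (raag \<Gamma>)) \<subseteq> Id"
    proof
      fix r assume "r \<in> step_relation wdist k (carrier (raag \<Gamma>))"
      then obtain g h where gh: "r = (g, h)" "g \<in> carrier (raag \<Gamma>)" "h \<in> carrier (raag \<Gamma>)" "wdist g h \<le> k"
        by (auto simp: step_relation_def)
      then have "wdist g h = 0" using \<open>\<not> 1 \<le> k\<close> by (simp add: word_dist_def)
      then show "r \<in> Id" using gh by simp
    qed
    from rtrancl_mono[OF this] have "(step_relation wdist k (carrier (raag \<Gamma>)))\<^sup>* \<subseteq> Id" by simp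
    then have one_point: "g = h" if "g \<in> carrier (raag \<Gamma>)" "h \<in> carrier (raag \<Gamma>)" for g h
      using kX that unfolding k_connected_step_relation by blast
    obtain Z C\<^sub>1 C\<^sub>2 x y where C: "k_component wdist k (far_part Z L) C\<^sub>1"
      "k_component wdist k (far_part Z L) C\<^sub>2" "C\<^sub>1 \<noteq> C\<^sub>2" "x \<in> C\<^sub>1" "y \<in> C\<^sub>2"
      using sepD[OF order_refl] by blast
    have "C\<^sub>1 \<subseteq> carrier (raag \<Gamma>)" "C\<^sub>2 \<subseteq> carrier (raag \<Gamma>)"
      using C(1,2) by (auto simp: k_component_def far_part_def)
    then have "C\<^sub>1 = C\<^sub>2" using C(4,5) one_point by blast
    then show False using C(3) by simp
  qed
  obtain D where D: "D \<ge> 0" and linked: "\<forall>Z\<in>\<Z>. \<forall>x\<in>carrier (raag \<Gamma>). \<forall>y\<in>carrier (raag \<Gamma>).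
    (\<forall>z\<in>Z. D \<le> wdist x z) \<longrightarrow> (\<forall>z\<in>Z. D \<le> wdist y z) \<longrightarrow> (x, y) \<in> linked Z L k"
    using far_points_linked[OF \<Z> sub L k] by blast
  obtain Z C\<^sub>1 C\<^sub>2 x y where Z: "Z \<in> \<Z>" and C: "k_component wdist k (far_part Z L) C\<^sub>1"
    "k_component wdist k (far_part Z L) C\<^sub>2" "C\<^sub>1 \<noteq> C\<^sub>2" "x \<in> C\<^sub>1" "y \<in> C\<^sub>2"
    and xy: "ereal D \<le> set_dist wdist x Z" "ereal D \<le> set_dist wdist y Z"
    using sepD[OF D] by blast
  have "x \<in> carrier (raag \<Gamma>)" "y \<in> carrier (raag \<Gamma>)"
    using C by (auto simp: k_component_def far_part_def)
  then have "(x, y) \<in> linked Z L k"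
    using linked Z xy set_dist_le[of _ Z D] by blast
  from k_component_unique[OF C(1,2) commute C(4,5) this] C(3) show False by simp
qed

end

theorem proposition6p8:
  fixes \<Gamma> :: "'a pair_pre_digraph" and S :: "'a word set set"
  assumes "pair_graph \<Gamma>" and "unpinched \<Gamma>"
    and "finite_generating_set (raag \<Gamma>) S"
    and "admits_subexp_separating_family (raag \<Gamma>) S"
  shows "\<exists>\<Gamma>' :: nat pair_pre_digraph.
           pair_graph \<Gamma>' \<and> triangle_free \<Gamma>' \<and> unpinched \<Gamma>' \<and>
           (\<forall>S'. finite_generating_set (raag \<Gamma>') S' \<longrightarrow>
                 admits_subexp_separating_family (raag \<Gamma>') S')"
proof -
  interpret unpinched_raag \<Gamma> S using assms(1-3) by (rule unpinched_raag.intro)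
  show ?thesis using no_subexp_separating_family assms(4) by contradiction
qed

end
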